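(* Let $\mathcal{H}$ be an infinite-dimensional Hilbert space and $I$ a non-empty index set with $|I|\le\dim(\mathcal{H})$. Let $\{T_i\}_{i\in I}$ be a family of contractive $C_0$-semigroups on $\mathcal{H}$. Then there exist a directed set $\Lambda$ and a net $(\{U_i^{(\alpha)}\}_{i\in I})_{\alpha\in\Lambda}$ of families of strongly continuous unitary representations of $\mathbb{R}$ on $\mathcal{H}$ such that for all $\xi,\eta\in\mathcal{H}$ $$\sup_{\substack{N\in\mathbb{N}_0,\\ (i_k)_{k=1}^N\subseteq I,\\ (t_k)_{k=1}^N\subseteq\mathbb{R}_{\ge 0}}}\left|\left\langle\Big(\prod_{k=1}^{N}T_{i_k}(t_k)-\prod_{k=1}^{N}U^{(\alpha)}_{i_k}(t_k)\Big)\xi,\ \eta\right\rangle\right|\ \underset{\alpha}{\longrightarrow}\ 0.$$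
   Context: Hilbert spaces are complex; $\dim(\mathcal{H})$ is the Hilbert space dimension (cardinality of an orthonormal basis). $\mathbb{N}_0=\{0,1,2,\ldots\}$. Products are ordered left to right, and empty products are the identity. The semigroups $T_i$ are not assumed to commute. *)

theory Defs
  imports "HOL-Analysis.Analysis"
begin

unbundle cardinal_syntax

section \<open>Complex Hilbert spaces\<close>

text \<open>
  The inner product is linear in its first argument. Its positive definiteness follows from
  the last axiom, because \<^term>\<open>norm\<close> is already a norm in the class \<^class>\<open>banach\<close>.
\<close>

class complex_hilbert_space = banach +
  fixes scaleC :: "complex \<Rightarrow> 'a \<Rightarrow> 'a"
    and cinner :: "'a \<Rightarrow> 'a \<Rightarrow> complex"
  assumes scaleC_add_right: "scaleC a (x + y) = scaleC a x + scaleC a y"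
    and scaleC_add_left: "scaleC (a + b) x = scaleC a x + scaleC b x"
    and scaleC_scaleC: "scaleC a (scaleC b x) = scaleC (a * b) x"
    and scaleR_scaleC: "scaleR r x = scaleC (complex_of_real r) x"
    and cinner_commute: "cinner x y = cnj (cinner y x)"
    and cinner_add_left: "cinner (x + y) z = cinner x z + cinner y z"
    and cinner_scaleC_left: "cinner (scaleC a x) y = a * cinner x y"
    and cinner_self: "cinner x x = complex_of_real ((norm x)\<^sup>2)"

lemma scaleC_one: "scaleC 1 x = (x :: 'a::complex_hilbert_space)"
  using scaleR_scaleC[of 1 x] by simp

global_interpretation complex_vector:
  vector_space "scaleC :: complex \<Rightarrow> 'a \<Rightarrow> 'a::complex_hilbert_space"
  by unfold_locales
    (simp_all add: scaleC_add_right scaleC_add_left scaleC_scaleC scaleC_one)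

definition orthonormal_basis :: "'a::complex_hilbert_space set \<Rightarrow> bool" where
  "orthonormal_basis B \<longleftrightarrow>
     (\<forall>x\<in>B. norm x = 1) \<and>
     (\<forall>x\<in>B. \<forall>y\<in>B. x \<noteq> y \<longrightarrow> cinner x y = 0) \<and>
     closure (complex_vector.span B) = UNIV"

text \<open>
  The dimension, as a cardinal (a wellorder in the style of the HOL cardinal library). Every
  Hilbert space has an orthonormal basis, and any two of them are equipotent.
\<close>

definition hilbert_dim :: "'a::complex_hilbert_space itself \<Rightarrow> 'a rel" where
  "hilbert_dim _ = |SOME B :: 'a set. orthonormal_basis B|"

section \<open>Semigroups and unitary representations\<close>

definition bounded_clinear :: "('a::complex_hilbert_space \<Rightarrow> 'a) \<Rightarrow> bool" where
  "bounded_clinear A \<longleftrightarrow> bounded_linear A \<and> (\<forall>c x. A (scaleC c x) = scaleC c (A x))"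

definition unitary :: "('a::complex_hilbert_space \<Rightarrow> 'a) \<Rightarrow> bool" where
  "unitary A \<longleftrightarrow> bounded_clinear A \<and> surj A \<and> (\<forall>x y. cinner (A x) (A y) = cinner x y)"

text \<open>Only the values of a semigroup at nonnegative times are meaningful.\<close>

definition contractive_C0_semigroup ::
    "(real \<Rightarrow> 'a::complex_hilbert_space \<Rightarrow> 'a) \<Rightarrow> bool" where
  "contractive_C0_semigroup T \<longleftrightarrow>
     (\<forall>t\<ge>0. bounded_clinear (T t) \<and> onorm (T t) \<le> 1) \<and>
     T 0 = id \<and>
     (\<forall>s\<ge>0. \<forall>t\<ge>0. T (s + t) = T s \<circ> T t) \<and>
     (\<forall>x. continuous_on {0..} (\<lambda>t. T t x))"

definition unitary_representation ::
    "(real \<Rightarrow> 'a::complex_hilbert_space \<Rightarrow> 'a) \<Rightarrow> bool" where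
  "unitary_representation U \<longleftrightarrow>
     (\<forall>t. unitary (U t)) \<and>
     U 0 = id \<and>
     (\<forall>s t. U (s + t) = U s \<circ> U t) \<and>
     (\<forall>x. continuous_on UNIV (\<lambda>t. U t x))"

text \<open>
  The list \<open>[(i\<^sub>1, t\<^sub>1), \<dots>, (i\<^sub>N, t\<^sub>N)]\<close> yields the operator
  \<open>T i\<^sub>1 t\<^sub>1 \<circ> \<dots> \<circ> T i\<^sub>N t\<^sub>N\<close>.
\<close>

definition ordered_prod :: "('i \<Rightarrow> real \<Rightarrow> 'a \<Rightarrow> 'a) \<Rightarrow> ('i \<times> real) list \<Rightarrow> 'a \<Rightarrow> 'a" where
  "ordered_prod T ws = foldr (\<lambda>(i, t) A. T i t \<circ> A) ws id"

section \<open>Nets\<close>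

definition directed_set :: "'d set \<Rightarrow> ('d \<Rightarrow> 'd \<Rightarrow> bool) \<Rightarrow> bool" where
  "directed_set D le \<longleftrightarrow>
     D \<noteq> {} \<and>
     (\<forall>a\<in>D. le a a) \<and>
     (\<forall>a\<in>D. \<forall>b\<in>D. \<forall>c\<in>D. le a b \<longrightarrow> le b c \<longrightarrow> le a c) \<and>
     (\<forall>a\<in>D. \<forall>b\<in>D. \<exists>c\<in>D. le a c \<and> le b c)"

definition net_filter :: "'d set \<Rightarrow> ('d \<Rightarrow> 'd \<Rightarrow> bool) \<Rightarrow> 'd filter" where
  "net_filter D le = (INF a\<in>D. principal {b\<in>D. le a b})"

lemma eventually_net_filter:
  assumes "directed_set D le"
  shows "eventually P (net_filter D le) \<longleftrightarrow> (\<exists>a\<in>D. \<forall>b\<in>D. le a b \<longrightarrow> P b)"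
proof -
  have "eventually P (net_filter D le) \<longleftrightarrow>
      (\<exists>a\<in>D. eventually P (principal {b\<in>D. le a b}))"
    unfolding net_filter_def
  proof (rule eventually_INF_base)
    show "D \<noteq> {}" using assms by (simp add: directed_set_def)
    fix a b assume "a \<in> D" "b \<in> D"
    then obtain c where "c \<in> D" "le a c" "le b c"
      using assms unfolding directed_set_def by blast
    moreover from this \<open>a \<in> D\<close> \<open>b \<in> D\<close>
    have "{x\<in>D. le c x} \<subseteq> {x\<in>D. le a x} \<inter> {x\<in>D. le b x}"
      using assms unfolding directed_set_def by blast
    ultimately show "\<exists>x\<in>D. principal {y\<in>D. le x y} \<le>
        inf (principal {y\<in>D. le a y}) (principal {y\<in>D. le b y})"
      by auto
  qed
  then show ?thesis by (auto simp: eventually_principal)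
qed

text \<open>
  HOL cannot quantify existentially over the type of a directed set. For nets of families of
  operators on \<open>H\<close> whose matrix coefficient deviations (below) tend to \<open>0\<close> it is no loss to
  draw the indices from the subsets of \<open>H\<close>: given such a net over any directed set, assign to each
  finite \<open>F \<subseteq> H\<close>, ordered by inclusion, a member with deviation at most \<open>1\<close> at all
  \<open>\<xi>, \<eta> \<in> F\<close>; convergence to \<open>0\<close> follows by scaling \<open>\<xi>\<close>.
\<close>

text \<open>
  The largest deviation, over all finite words in \<open>I\<close> and nonnegative times, between two
  families of operators in the matrix coefficient at \<open>\<xi>, \<eta>\<close>. It is taken in the extended
  reals, where every supremum exists.
\<close>

definition coefficient_deviation ::
    "'i set \<Rightarrow> ('i \<Rightarrow> real \<Rightarrow> 'a \<Rightarrow> 'a) \<Rightarrow> ('i \<Rightarrow> real \<Rightarrow> 'a \<Rightarrow> 'a) \<Rightarrow>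
      'a::complex_hilbert_space \<Rightarrow> 'a \<Rightarrow> ereal" where
  "coefficient_deviation I T U \<xi> \<eta> =
     (SUP ws\<in>lists (I \<times> {0..}).
        ereal (cmod (cinner (ordered_prod T ws \<xi> - ordered_prod U ws \<xi>) \<eta>)))"

end

theory Submission
  imports Defs
begin

text \<open>
  The semigroups are dilated exactly and jointly; approximation enters only because the dilation
  has to live on \<open>H\<close> itself.

  For a single semigroup \<open>T\<close>, Sz.-Nagy's kernel \<open>\<langle>T(s - t) \<xi>, \<eta>\<rangle>\<close> on \<open>\<real> \<times> H\<close> is positive semidefinite
  (\<open>psd_dilation_kernel\<close>), hence the Gram kernel of vectors \<open>v(s, \<xi>)\<close>, and the translations
  \<open>v(s, \<xi>) \<mapsto> v(s + t, \<xi>)\<close> form a unitary group \<open>U\<close>. With the isometric copy \<open>J \<xi> = v(0, \<xi>)\<close> of \<open>H\<close>, the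
  errors \<open>U(t) J \<xi> - J T(t) \<xi>\<close>, for \<open>t \<ge> 0\<close>, are orthogonal to \<open>J H\<close>, and their span is invariant under
  \<open>U(t)\<close> for \<open>t \<ge> 0\<close> (\<open>unitary_dilation\<close>).

  For a family, let the dilation spaces have \<open>J H\<close> in common, let them be mutually orthogonal
  otherwise, and let each \<open>U\<^sub>i\<close> act as the identity on the complement of its own space. Then the
  errors of all semigroups together span a subspace that is orthogonal to \<open>J H\<close> and invariant under
  all \<open>U\<^sub>i(t)\<close> with \<open>t \<ge> 0\<close>, since \<open>U\<^sub>i\<close> fixes the errors of the other indices. By induction over the
  word, \<open>\<langle>\<Prod> U\<^sub>i(t) J \<xi>, J \<eta>\<rangle> = \<langle>\<Prod> T\<^sub>i(t) \<xi>, \<eta>\<rangle>\<close> for all words with nonnegative times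
  (\<open>joint_unitary_dilation\<close>).

  The cardinality assumption provides the room. By strong continuity the vectors \<open>v(s, \<xi>)\<close> with
  rational \<open>s\<close> and with \<open>\<xi>\<close> in an orthonormal basis \<open>B\<close> are total, so \<open>|I| \<cdot> \<aleph>\<^sub>0 \<cdot> |B| \<le> |B|\<close> directions
  besides \<open>J H\<close> suffice, and the whole construction can be carried out in \<open>H\<close>
  (\<open>kernel_realization\<close>). Moreover, for any finite \<open>F \<subseteq> B\<close> the isometry \<open>J = J\<^sub>F\<close> can be taken to fix \<open>F\<close>
  pointwise (\<open>approximate_unitary_dilation\<close>).

  Along the net of finite subsets of \<open>B\<close> the isometries \<open>J\<^sub>F\<close> then converge strongly to the identity.
  As products of unitaries are contractive, the coefficients of the two products at \<open>\<xi>, \<eta>\<close> differ by at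
  most \<open>\<parallel>\<xi> - J\<^sub>F \<xi>\<parallel> \<parallel>\<eta>\<parallel> + \<parallel>\<xi>\<parallel> \<parallel>\<eta> - J\<^sub>F \<eta>\<parallel>\<close>, whatever the word (\<open>coefficient_deviation_bound\<close>).
\<close>

section \<open>The inner product\<close>

lemma cinner_add_right: "cinner x (y + z) = cinner x y + cinner x (z::'h::complex_hilbert_space)"
  by (metis cinner_add_left cinner_commute complex_cnj_add)

lemma cinner_scaleC_right: "cinner x (scaleC a y) = cnj a * cinner x (y::'h::complex_hilbert_space)"
  by (metis cinner_commute cinner_scaleC_left complex_cnj_mult)

lemma norm_add_square:
  "(norm (x + y))\<^sup>2 = (norm x)\<^sup>2 + 2 * Re (cinner x y) + (norm (y::'h::complex_hilbert_space))\<^sup>2"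
proof -
  have "complex_of_real ((norm (x + y))\<^sup>2) = cinner (x + y) (x + y)"
    by (simp only: cinner_self)
  also have "\<dots> = cinner x x + cinner x y + cnj (cinner x y) + cinner y y"
    by (simp add: cinner_add_left cinner_add_right cinner_commute[of y x])
  finally have "Re (complex_of_real ((norm (x + y))\<^sup>2))
      = Re (cinner x x + cinner x y + cnj (cinner x y) + cinner y y)"
    by (rule arg_cong)
  then show ?thesis by (simp only: cinner_self Re_complex_of_real plus_complex.sel cnj.sel)
qed

lemma mult_cnj_cmod: "c * cnj c = (complex_of_real (cmod c))\<^sup>2"
  by (metis complex_norm_square of_real_power)

lemma norm_scaleC: "norm (scaleC c (x::'h::complex_hilbert_space)) = cmod c * norm x"
proof -
  have "complex_of_real ((norm (scaleC c x))\<^sup>2) = c * (cnj c * cinner x x)"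
    by (simp only: cinner_self[symmetric] cinner_scaleC_left cinner_scaleC_right mult.left_commute)
  also have "\<dots> = complex_of_real ((cmod c * norm x)\<^sup>2)"
    by (simp add: cinner_self power_mult_distrib mult.assoc[symmetric] mult_cnj_cmod)
  finally have "(norm (scaleC c x))\<^sup>2 = (cmod c * norm x)\<^sup>2"
    using of_real_eq_iff by blast
  then show ?thesis by (simp add: power2_eq_iff_nonneg)
qed

lemma cauchy_schwarz: "cmod (cinner x y) \<le> norm x * norm (y::'h::complex_hilbert_space)"
proof (cases "norm y = 0")
  case True
  then have "y = scaleC 0 y" by simp
  then have "cinner x y = 0" by (metis cinner_scaleC_right complex_cnj_zero mult_zero_left)
  then show ?thesis by simp
next
  case False
  define a where "a = - cinner x y / complex_of_real ((norm y)\<^sup>2)"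
  have "Re (cinner x (scaleC a y)) = - (cmod (cinner x y))\<^sup>2 / (norm y)\<^sup>2"
  proof -
    have "cinner x (scaleC a y) = cnj a * cinner x y" by (rule cinner_scaleC_right)
    also have "\<dots> = - (cinner x y * cnj (cinner x y)) / complex_of_real ((norm y)\<^sup>2)"
      by (simp add: a_def)
    also have "\<dots> = complex_of_real (- (cmod (cinner x y))\<^sup>2 / (norm y)\<^sup>2)"
      by (simp add: mult_cnj_cmod)
    finally show ?thesis by (metis Re_complex_of_real)
  qed
  moreover have "(norm (scaleC a y))\<^sup>2 = (cmod (cinner x y))\<^sup>2 / (norm y)\<^sup>2"
    using False
    by (simp add: norm_scaleC a_def norm_divide power_mult_distrib power_divide field_simps norm_power)
  ultimately have "(norm (x + scaleC a y))\<^sup>2 = (norm x)\<^sup>2 - (cmod (cinner x y))\<^sup>2 / (norm y)\<^sup>2"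
    by (simp add: norm_add_square)
  then have "(cmod (cinner x y))\<^sup>2 / (norm y)\<^sup>2 \<le> (norm x)\<^sup>2"
    by (smt (verit) zero_le_power2)
  then have "(cmod (cinner x y))\<^sup>2 \<le> (norm x * norm y)\<^sup>2"
    using False by (simp add: power_mult_distrib divide_le_eq)
  then show ?thesis by (meson mult_nonneg_nonneg norm_ge_zero power2_le_imp_le)
qed

lemma bounded_bilinear_cinner:
  "bounded_bilinear (cinner :: 'h::complex_hilbert_space \<Rightarrow> 'h \<Rightarrow> complex)"
proof
  show "\<exists>K. \<forall>a b. norm (cinner a (b::'h)) \<le> norm a * norm b * K"
    by (rule exI[of _ 1]) (simp add: cauchy_schwarz)
qed (auto simp: cinner_add_left cinner_add_right scaleR_scaleC cinner_scaleC_left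
    cinner_scaleC_right scaleR_conv_of_real)

interpretation cinner: bounded_bilinear "cinner :: 'h::complex_hilbert_space \<Rightarrow> 'h \<Rightarrow> complex"
  by (rule bounded_bilinear_cinner)

lemma bounded_linear_scaleC: "bounded_linear (scaleC c :: 'h::complex_hilbert_space \<Rightarrow> 'h)"
  by (rule bounded_linear_intro[where K = "cmod c"])
    (simp_all add: scaleC_add_right scaleR_scaleC scaleC_scaleC norm_scaleC mult.commute)

lemma norm_diff_square:
  "(norm (x - y))\<^sup>2 = (norm x)\<^sup>2 - 2 * Re (cinner x y) + (norm (y::'h::complex_hilbert_space))\<^sup>2"
  using norm_add_square[of x "- y"] by (simp add: cinner.minus_right)

lemma parallelogram:
  "(norm (x + y))\<^sup>2 + (norm (x - y))\<^sup>2 = 2 * (norm x)\<^sup>2 + 2 * (norm (y::'h::complex_hilbert_space))\<^sup>2"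
  by (simp add: norm_add_square norm_diff_square)

lemma Re_cinner_bound: "2 * Re (cinner x y) \<le> (norm x)\<^sup>2 + (norm (y::'h::complex_hilbert_space))\<^sup>2"
  using norm_diff_square[of x y] zero_le_power2[of "norm (x - y)"] by linarith

lemma cinner_self_eq_0: "cinner x x = 0 \<longleftrightarrow> (x::'h::complex_hilbert_space) = 0"
  by (simp add: cinner_self)

lemma cinner_eq_0_commute: "cinner x y = 0 \<longleftrightarrow> cinner y (x::'h::complex_hilbert_space) = 0"
  using cinner_commute[of x y] by auto

section \<open>Closed complex spans\<close>

definition closed_cspan :: "'h::complex_hilbert_space set \<Rightarrow> 'h set" where
  "closed_cspan A = closure (complex_vector.span A)"

lemma closed_cspan_superset: "A \<subseteq> closed_cspan A"
  unfolding closed_cspan_def using closure_subset complex_vector.span_superset by blast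

lemma closed_cspan_base: "a \<in> A \<Longrightarrow> a \<in> closed_cspan A"
  using closed_cspan_superset by blast

lemma closed_cspan_mono: "A \<subseteq> B \<Longrightarrow> closed_cspan A \<subseteq> closed_cspan B"
  unfolding closed_cspan_def by (intro closure_mono complex_vector.span_mono)

lemma closed_cspan_minimal:
  assumes "A \<subseteq> S" "complex_vector.subspace S" "closed S"
  shows "closed_cspan A \<subseteq> S"
  unfolding closed_cspan_def
  by (intro closure_minimal complex_vector.span_minimal assms)

lemma subspace_closed_cspan: "complex_vector.subspace (closed_cspan A)"
proof (rule complex_vector.subspaceI)
  show "0 \<in> closed_cspan A"
    unfolding closed_cspan_def using closure_subset complex_vector.span_zero by blast
  fix x y assume "x \<in> closed_cspan A" "y \<in> closed_cspan A"
  then obtain f g where "\<And>n. f n \<in> complex_vector.span A" "f \<longlonglongrightarrow> x"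
      "\<And>n. g n \<in> complex_vector.span A" "g \<longlonglongrightarrow> y"
    unfolding closed_cspan_def closure_sequential by blast
  then show "x + y \<in> closed_cspan A"
    unfolding closed_cspan_def closure_sequential
    by (intro exI[of _ "\<lambda>n. f n + g n"]) (auto intro: tendsto_add complex_vector.span_add)
next
  fix c x assume "x \<in> closed_cspan A"
  then obtain f where "\<And>n. f n \<in> complex_vector.span A" "f \<longlonglongrightarrow> x"
    unfolding closed_cspan_def closure_sequential by blast
  then show "scaleC c x \<in> closed_cspan A"
    unfolding closed_cspan_def closure_sequential
    by (intro exI[of _ "\<lambda>n. scaleC c (f n)"])
      (auto intro: bounded_linear.tendsto[OF bounded_linear_scaleC] complex_vector.span_scale)
qed

lemmas closed_cspan_intros =
  complex_vector.subspace_0[OF subspace_closed_cspan]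
  complex_vector.subspace_add[OF subspace_closed_cspan]
  complex_vector.subspace_diff[OF subspace_closed_cspan]
  complex_vector.subspace_scale[OF subspace_closed_cspan]

lemma closed_closed_cspan: "closed (closed_cspan A)"
  by (simp add: closed_cspan_def)

lemma closed_cspan_subset: "A \<subseteq> closed_cspan B \<Longrightarrow> closed_cspan A \<subseteq> closed_cspan B"
  by (intro closed_cspan_minimal subspace_closed_cspan closed_closed_cspan)

lemma closed_cspan_orthogonal:
  assumes "x \<in> closed_cspan A" "\<And>a. a \<in> A \<Longrightarrow> cinner a y = 0"
  shows "cinner x y = 0"
proof -
  have "closed_cspan A \<subseteq> {x. cinner x y = 0}"
  proof (rule closed_cspan_minimal)
    show "complex_vector.subspace {x. cinner x y = 0}"
      by (rule complex_vector.subspaceI)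
        (simp_all add: cinner.zero_left cinner_add_left cinner_scaleC_left)
    show "closed {x. cinner x y = 0}"
      by (intro closed_Collect_eq continuous_intros cinner.continuous_on)
  qed (use assms(2) in auto)
  with assms(1) show ?thesis by auto
qed

lemma closed_cspan_eqI:
  assumes "u \<in> closed_cspan A" "w \<in> closed_cspan A" "\<And>a. a \<in> A \<Longrightarrow> cinner a u = cinner a w"
  shows "u = w"
proof -
  have "cinner (u - w) (u - w) = 0"
    using assms by (intro closed_cspan_orthogonal[where A = A and x = "u - w"])
      (auto simp: cinner.diff_right intro: closed_cspan_intros(3))
  then show ?thesis by (simp add: cinner_self_eq_0)
qed

section \<open>Bounded functionals\<close>

text \<open>
  The subspace \<open>C\<close> is the graph of a functional on a subspace of \<open>H\<close>, and \<open>u\<close> minimizes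
  \<open>\<parallel>w\<parallel>\<^sup>2 - 2 Re a\<close> over its closure: a minimizing sequence is Cauchy by the parallelogram law,
  and the first variation at the limit is the desired identity. The bound makes the infimum
  finite. Starting from a graph lets functionals be given on linear combinations, since their
  independence of the chosen combination is part of the conclusion.
\<close>

lemma riesz_on_graph:
  fixes C :: "('h::complex_hilbert_space \<times> complex) set"
  assumes zero: "(0, 0) \<in> C"
    and add: "\<And>w a w' a'. (w, a) \<in> C \<Longrightarrow> (w', a') \<in> C \<Longrightarrow> (w + w', a + a') \<in> C"
    and scale: "\<And>c w a. (w, a) \<in> C \<Longrightarrow> (scaleC c w, c * a) \<in> C"
    and bound: "\<And>w a. (w, a) \<in> C \<Longrightarrow> 2 * Re a \<le> \<kappa> + (norm w)\<^sup>2"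
  obtains u where "u \<in> closure (fst ` C)" "\<And>w a. (w, a) \<in> C \<Longrightarrow> cinner w u = a"
    "(norm u)\<^sup>2 \<le> \<kappa>"
proof -
  define q where "q p = (norm (fst p))\<^sup>2 - 2 * Re (snd p)" for p :: "'h \<times> complex"
  define m where "m = Inf (q ` C)"
  have ne: "q ` C \<noteq> {}" using zero by auto
  have bdd: "bdd_below (q ` C)"
    using bound by (intro bdd_belowI[of _ "- \<kappa>"]) (force simp: q_def)
  have m_le: "m \<le> q p" if "p \<in> C" for p
    unfolding m_def using that bdd by (intro cInf_lower) auto
  have "\<exists>p\<in>C. q p < m + 1 / real (Suc n)" for n
    using cInf_lessD[OF ne, of "m + 1 / real (Suc n)"] by (auto simp: m_def)
  then obtain p where p: "\<And>n. p n \<in> C" "\<And>n. q (p n) < m + 1 / real (Suc n)"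
    by metis
  define w where "w n = fst (p n)" for n
  have mid: "(norm (w n - w k))\<^sup>2 \<le> 2 * (1 / real (Suc n) + 1 / real (Suc k))" for n k
  proof -
    define r where "r = (scaleC (1/2) (w n + w k), (1/2) * (snd (p n) + snd (p k)))"
    have "r \<in> C"
      unfolding r_def w_def by (intro scale add) (simp_all add: p)
    have "q r = (norm (w n + w k))\<^sup>2 / 4 - Re (snd (p n)) - Re (snd (p k))"
      by (simp add: q_def r_def norm_scaleC power_mult_distrib power_divide
          add_divide_distrib)
    with m_le[OF \<open>r \<in> C\<close>] p(2)[of n] p(2)[of k] parallelogram[of "w n" "w k"]
    show ?thesis by (simp add: q_def w_def)
  qed
  have "Cauchy w"
  proof (rule metric_CauchyI)
    fix \<epsilon> :: real assume "\<epsilon> > 0"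
    then obtain M where M: "1 / real (Suc M) < \<epsilon>\<^sup>2 / 4"
      using nat_approx_posE[of "\<epsilon>\<^sup>2 / 4"] by auto
    show "\<exists>M. \<forall>n\<ge>M. \<forall>k\<ge>M. dist (w n) (w k) < \<epsilon>"
    proof (intro exI[of _ M] allI impI)
      fix n k assume "M \<le> n" "M \<le> k"
      then have "1 / real (Suc n) \<le> 1 / real (Suc M)" "1 / real (Suc k) \<le> 1 / real (Suc M)"
        by (simp_all add: frac_le)
      moreover have "x < e" if "x \<le> 2 * (a + b)" "a \<le> c" "b \<le> c" "c < e / 4" for x a b c e :: real
        using that by (simp add: field_simps)
      ultimately have "(norm (w n - w k))\<^sup>2 < \<epsilon>\<^sup>2"
        using mid[of n k] M by blast
      then show "dist (w n) (w k) < \<epsilon>"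
        using \<open>\<epsilon> > 0\<close> by (simp add: dist_norm power2_less_imp_less)
    qed
  qed
  then obtain u where u: "w \<longlonglongrightarrow> u"
    using Cauchy_convergent convergent_def by blast
  have u_closure: "u \<in> closure (fst ` C)"
    unfolding closure_sequential using u p(1) by (intro exI[of _ w]) (auto simp: w_def)
  have eq: "cinner x u = a" if "(x, a) \<in> C" for x a
  proof -
    have var: "0 \<le> 2 * Re (t * (cinner x u - a)) + (cmod t)\<^sup>2 * (norm x)\<^sup>2" for t
    proof (rule LIMSEQ_le)
      show "(\<lambda>n. - (1 / real (Suc n))) \<longlonglongrightarrow> 0"
        using tendsto_minus[OF LIMSEQ_inverse_real_of_nat] by (simp add: inverse_eq_divide)
      show "(\<lambda>n. 2 * Re (t * (cinner x (w n) - a)) + (cmod t)\<^sup>2 * (norm x)\<^sup>2)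
          \<longlonglongrightarrow> 2 * Re (t * (cinner x u - a)) + (cmod t)\<^sup>2 * (norm x)\<^sup>2"
        by (intro tendsto_intros cinner.tendsto u)
      have "- (1 / real (Suc n)) \<le> 2 * Re (t * (cinner x (w n) - a)) + (cmod t)\<^sup>2 * (norm x)\<^sup>2"
        for n
      proof -
        have "(w n + scaleC t x, snd (p n) + t * a) \<in> C"
          using p(1)[of n] that unfolding w_def by (intro add scale) auto
        from m_le[OF this] p(2)[of n] show ?thesis
          by (simp add: q_def w_def norm_add_square norm_scaleC power_mult_distrib
              cinner_commute[of "fst (p n)"] cinner_scaleC_left right_diff_distrib)
      qed
      then show "\<exists>N. \<forall>n\<ge>N. - (1 / real (Suc n))
          \<le> 2 * Re (t * (cinner x (w n) - a)) + (cmod t)\<^sup>2 * (norm x)\<^sup>2"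
        by blast
    qed
    \<comment> \<open>The direction \<open>t = - s d\<^sup>*\<close> gives the linear term \<open>- 2 s |d|\<^sup>2\<close>, and \<open>s\<close> is so small that the
      quadratic term \<open>s\<^sup>2 |d|\<^sup>2 \<parallel>x\<parallel>\<^sup>2\<close> compensates at most half of it.\<close>
    define d where "d = cinner x u - a"
    define s where "s = 1 / (1 + (norm x)\<^sup>2)"
    have s: "s > 0" "s * (norm x)\<^sup>2 < 1"
      by (auto simp: s_def field_simps add_pos_nonneg)
    have "Re (- complex_of_real s * cnj d * d) = - s * (cmod d)\<^sup>2"
    proof -
      have "- complex_of_real s * cnj d * d = complex_of_real (- s * (cmod d)\<^sup>2)"
        by (simp add: mult_cnj_cmod mult.commute[of "cnj d"])
      then show ?thesis by (metis Re_complex_of_real)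
    qed
    moreover have "(cmod (- complex_of_real s * cnj d))\<^sup>2 = s * s * (cmod d)\<^sup>2"
      by (simp add: norm_mult power_mult_distrib power2_eq_square)
    ultimately have "0 \<le> s * (cmod d)\<^sup>2 * (s * (norm x)\<^sup>2 - 2)"
      using var[of "- complex_of_real s * cnj d"] unfolding d_def[symmetric]
      by (simp add: algebra_simps)
    then have "d = 0"
      using s by (simp add: zero_le_mult_iff mult_le_0_iff)
    then show ?thesis by (simp add: d_def)
  qed
  have "2 * (norm u)\<^sup>2 \<le> \<kappa> + (norm u)\<^sup>2"
  proof (rule LIMSEQ_le)
    show "(\<lambda>n. 2 * Re (cinner (w n) u)) \<longlonglongrightarrow> 2 * (norm u)\<^sup>2"
    proof -
      have "2 * (norm u)\<^sup>2 = 2 * Re (cinner u u)" by (simp add: cinner_self)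
      then show ?thesis by (auto intro!: tendsto_intros cinner.tendsto u)
    qed
    show "(\<lambda>n. \<kappa> + (norm (w n))\<^sup>2) \<longlonglongrightarrow> \<kappa> + (norm u)\<^sup>2"
      by (intro tendsto_intros u)
    have "2 * Re (cinner (w n) u) \<le> \<kappa> + (norm (w n))\<^sup>2" for n
      using p(1)[of n] eq[of "w n" "snd (p n)"] bound[of "w n" "snd (p n)"] by (simp add: w_def)
    then show "\<exists>N. \<forall>n\<ge>N. 2 * Re (cinner (w n) u) \<le> \<kappa> + (norm (w n))\<^sup>2" by blast
  qed
  then show ?thesis using that u_closure eq by simp
qed

section \<open>Bounded operators and total sets\<close>

lemma bounded_clinearI:
  assumes "\<And>x y. A (x + y) = A x + A y" "\<And>c x. A (scaleC c x) = scaleC c (A x)"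
    "\<And>x. norm (A x) \<le> K * norm x"
  shows "bounded_clinear (A :: 'h::complex_hilbert_space \<Rightarrow> 'h)"
  unfolding bounded_clinear_def
proof (intro conjI allI)
  show "bounded_linear A"
    by (rule bounded_linear_intro[where K = K])
      (simp_all add: assms scaleR_scaleC mult.commute)
qed (rule assms(2))

lemma bounded_clinear_add: "bounded_clinear A \<Longrightarrow> A (x + y) = A x + A y"
  and bounded_clinear_diff: "bounded_clinear A \<Longrightarrow> A (x - y) = A x - A y"
  and bounded_clinear_zero: "bounded_clinear A \<Longrightarrow> A 0 = 0"
  and bounded_clinear_scaleC: "bounded_clinear A \<Longrightarrow> A (scaleC c x) = scaleC c (A x)"
  by (simp_all add: bounded_clinear_def linear_simps)

lemma bounded_clinear_continuous: "bounded_clinear A \<Longrightarrow> continuous_on S A"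
  by (simp add: bounded_clinear_def linear_continuous_on)

lemma bounded_clinear_compose:
  "bounded_clinear A \<Longrightarrow> bounded_clinear B \<Longrightarrow> bounded_clinear (\<lambda>x. A (B x))"
  unfolding bounded_clinear_def using bounded_linear_compose by auto

lemma bounded_clinear_ident: "bounded_clinear (\<lambda>x. x)"
  by (simp add: bounded_clinear_def)

lemma bounded_clinear_span_image:
  assumes "bounded_clinear A" "\<And>x. x \<in> S \<Longrightarrow> A x \<in> complex_vector.span R"
    and "x \<in> complex_vector.span S"
  shows "A x \<in> complex_vector.span R"
proof -
  have "complex_vector.span S \<subseteq> {x. A x \<in> complex_vector.span R}"
    using assms(1,2) by (intro complex_vector.span_minimal complex_vector.subspaceI)
      (auto simp: bounded_clinear_add bounded_clinear_zero bounded_clinear_scaleC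
        intro: complex_vector.span_zero complex_vector.span_add complex_vector.span_scale)
  with assms(3) show ?thesis by blast
qed

lemma bounded_clinear_eq_on_closed_cspan:
  assumes A: "bounded_clinear A" and B: "bounded_clinear B"
    and eq: "\<And>x. x \<in> S \<Longrightarrow> A x = B x" and x: "x \<in> closed_cspan S"
  shows "A x = B x"
proof -
  have "closed_cspan S \<subseteq> {x. A x = B x}"
    using eq
    by (intro closed_cspan_minimal complex_vector.subspaceI closed_Collect_eq
        bounded_clinear_continuous A B)
      (auto simp: bounded_clinear_add[OF A] bounded_clinear_add[OF B] bounded_clinear_zero[OF A]
        bounded_clinear_zero[OF B] bounded_clinear_scaleC[OF A] bounded_clinear_scaleC[OF B])
  with x show ?thesis by blast
qed

lemma isometry_preserves_cinner:
  assumes A: "bounded_clinear A" and iso: "\<And>x. norm (A x) = norm x"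
  shows "cinner (A x) (A y) = cinner x y"
proof -
  have re: "Re (cinner (A x) (A y)) = Re (cinner x y)" for x y
    using norm_add_square[of "A x" "A y"] norm_add_square[of x y]
    by (simp add: bounded_clinear_add[OF A, symmetric] iso)
  have "Im (cinner (A x) (A y)) = Im (cinner x y)"
    using re[of "scaleC \<i> x" y] by (simp add: bounded_clinear_scaleC[OF A] cinner_scaleC_left)
  with re show ?thesis by (simp add: complex_eq_iff)
qed

text \<open>
  For contractions, orbit maps of nearby vectors are uniformly close, so the vectors with a
  continuous orbit form a closed subspace.
\<close>

lemma strongly_continuous_on_closed_cspan:
  fixes U :: "real \<Rightarrow> 'h::complex_hilbert_space \<Rightarrow> 'h"
  assumes lin: "\<And>t. bounded_clinear (U t)" and contr: "\<And>t x. norm (U t x) \<le> norm x"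
    and cont: "\<And>x. x \<in> S \<Longrightarrow> continuous_on UNIV (\<lambda>t. U t x)"
    and x: "x \<in> closed_cspan S"
  shows "continuous_on UNIV (\<lambda>t. U t x)"
proof -
  have "closed_cspan S \<subseteq> {x. continuous_on UNIV (\<lambda>t. U t x)}"
  proof (rule closed_cspan_minimal)
    show "complex_vector.subspace {x. continuous_on UNIV (\<lambda>t. U t x)}"
      by (rule complex_vector.subspaceI)
        (auto simp: bounded_clinear_add[OF lin] bounded_clinear_zero[OF lin]
          bounded_clinear_scaleC[OF lin]
          intro: continuous_on_add bounded_linear.continuous_on[OF bounded_linear_scaleC])
    show "closed {x. continuous_on UNIV (\<lambda>t. U t x)}"
      unfolding closed_sequential_limits
    proof (intro allI impI, elim conjE)
      fix f l
      assume f: "\<forall>n. f n \<in> {x. continuous_on UNIV (\<lambda>t. U t x)}" and lim: "f \<longlonglongrightarrow> l"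
      have "uniform_limit UNIV (\<lambda>n t. U t (f n)) (\<lambda>t. U t l) sequentially"
      proof (rule uniform_limitI)
        fix e :: real assume "e > 0"
        have "dist (U t (f n)) (U t l) \<le> dist (f n) l" for n t
          using contr[of t "f n - l"] by (simp add: dist_norm bounded_clinear_diff[OF lin])
        then show "\<forall>\<^sub>F n in sequentially. \<forall>t\<in>UNIV. dist (U t (f n)) (U t l) < e"
          using tendstoD[OF lim \<open>e > 0\<close>] by (auto elim!: eventually_mono intro: le_less_trans)
      qed
      then show "l \<in> {x. continuous_on UNIV (\<lambda>t. U t x)}"
        using f by (auto intro!: uniform_limit_theorem[where f = "\<lambda>n t. U t (f n)"])
    qed
  qed (use cont in auto)
  with x show ?thesis by blast
qed

section \<open>Gram kernels and partial isometries\<close>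

text \<open>
  Linear combinations are indexed by lists of coefficients and points: concatenation is addition,
  and repeated points do no harm. With \<open>form\<close> below this models the free vector space over a
  type of points, equipped with the sesquilinear form of a kernel \<open>k\<close>.
\<close>

definition lincomb :: "('x \<Rightarrow> 'h::complex_hilbert_space) \<Rightarrow> (complex \<times> 'x) list \<Rightarrow> 'h" where
  "lincomb v zs = (\<Sum>(c, x)\<leftarrow>zs. scaleC c (v x))"

lemma lincomb_simps [simp]:
  "lincomb v [] = 0"
  "lincomb v ((c, x) # zs) = scaleC c (v x) + lincomb v zs"
  "lincomb v (zs @ ws) = lincomb v zs + lincomb v ws"
  by (simp_all add: lincomb_def)

lemma lincomb_scale:
  "lincomb v (map (\<lambda>(d, x). (c * d, x)) zs) = scaleC c (lincomb v zs)"
  by (induction zs) (auto simp: scaleC_add_right scaleC_scaleC)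

lemma lincomb_in_span:
  "snd ` set zs \<subseteq> S \<Longrightarrow> lincomb v zs \<in> complex_vector.span (v ` S)"
proof (induction zs)
  case (Cons z zs)
  then show ?case
    by (cases z) (auto intro!: complex_vector.span_add complex_vector.span_scale
      intro: complex_vector.span_base)
qed (simp add: complex_vector.span_zero)

definition form :: "('x \<Rightarrow> 'x \<Rightarrow> complex) \<Rightarrow> (complex \<times> 'x) list \<Rightarrow> (complex \<times> 'x) list \<Rightarrow> complex"
  where "form k zs ws = (\<Sum>(c, x)\<leftarrow>zs. \<Sum>(d, y)\<leftarrow>ws. c * cnj d * k x y)"

lemma form_simps [simp]:
  "form k [] ws = 0" "form k zs [] = 0"
  "form k ((c, x) # zs) ws = (\<Sum>(d, y)\<leftarrow>ws. c * cnj d * k x y) + form k zs ws"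
  by (simp_all add: form_def case_prod_unfold)

lemma form_Cons_right:
  "form k zs ((d, y) # ws) = (\<Sum>(c, x)\<leftarrow>zs. c * cnj d * k x y) + form k zs ws"
  by (induction zs) (auto simp: algebra_simps)

definition gram_on :: "('x \<Rightarrow> 'x \<Rightarrow> complex) \<Rightarrow> ('x \<Rightarrow> 'h::complex_hilbert_space) \<Rightarrow> 'x set \<Rightarrow> bool"
  where "gram_on k v S \<longleftrightarrow> (\<forall>x\<in>S. \<forall>y\<in>S. cinner (v x) (v y) = k x y)"

lemma cinner_lincomb_right: "cinner u (lincomb v zs) = (\<Sum>(c, x)\<leftarrow>zs. cnj c * cinner u (v x))"
  by (induction zs) (auto simp: cinner_add_right cinner_scaleC_right cinner.zero_right)

lemma form_gram:
  assumes "gram_on k v S" "snd ` set zs \<subseteq> S" "snd ` set ws \<subseteq> S"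
  shows "form k zs ws = cinner (lincomb v zs) (lincomb v ws)"
  using assms(2)
proof (induction zs)
  case (Cons z zs)
  obtain c x where z: "z = (c, x)" by force
  have "(\<Sum>(d, y)\<leftarrow>ws. c * cnj d * k x y) = (\<Sum>(d, y)\<leftarrow>ws. c * (cnj d * cinner (v x) (v y)))"
    using assms(1,3) Cons.prems z by (intro arg_cong[of _ _ sum_list] map_cong) 
      (force simp: gram_on_def mult.assoc)+
  also have "\<dots> = c * cinner (v x) (lincomb v ws)"
    by (simp add: cinner_lincomb_right sum_list_const_mult[symmetric] case_prod_unfold)
  finally show ?case
    using Cons z by (simp add: cinner_add_left cinner_scaleC_left)
qed (simp add: cinner.zero_left)

text \<open>
  The value \<open>V y\<close> represents the functional \<open>\<Sum> c w(x) \<mapsto> \<Sum> c \<langle>v(x), y\<rangle>\<close> on the span of \<open>w\<close>, which is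
  well defined and bounded by \<open>\<parallel>y\<parallel>\<close> because equal Gram kernels give combinations of equal norm.
  So \<open>V\<close> is the partial isometry from the closed span of \<open>v\<close> onto that of \<open>w\<close>, defined at once
  on the whole space.
\<close>

lemma gram_transport:
  fixes v w :: "'x \<Rightarrow> 'h::complex_hilbert_space"
  assumes gram: "\<forall>x\<in>S. \<forall>y\<in>S. cinner (w x) (w y) = cinner (v x) (v y)"
  shows "\<exists>V. bounded_clinear V \<and> (\<forall>y. norm (V y) \<le> norm y) \<and> (\<forall>x\<in>S. V (v x) = w x) \<and>
    (\<forall>y. V y \<in> closed_cspan (w ` S)) \<and> (\<forall>x\<in>S. \<forall>y. cinner (w x) (V y) = cinner (v x) y)"
proof -
  have "\<exists>u. u \<in> closed_cspan (w ` S) \<and> (\<forall>x\<in>S. cinner (w x) u = cinner (v x) y) \<and> norm u \<le> norm y"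
    for y
  proof -
    define C where "C = (\<lambda>zs. (lincomb w zs, cinner (lincomb v zs) y)) ` {zs. snd ` set zs \<subseteq> S}"
    have norm_eq: "norm (lincomb w zs) = norm (lincomb v zs)" if "snd ` set zs \<subseteq> S" for zs
    proof -
      have "cinner (lincomb w zs) (lincomb w zs) = form (\<lambda>x y. cinner (v x) (v y)) zs zs"
        by (rule form_gram[OF _ that that, symmetric]) (simp add: gram_on_def gram)
      also have "\<dots> = cinner (lincomb v zs) (lincomb v zs)"
        by (rule form_gram[OF _ that that]) (simp add: gram_on_def)
      finally have "(norm (lincomb w zs))\<^sup>2 = (norm (lincomb v zs))\<^sup>2"
        by (simp only: cinner_self of_real_eq_iff)
      then show ?thesis by (simp add: power2_eq_iff_nonneg)
    qed
    obtain u where u: "u \<in> closure (fst ` C)" "\<And>x a. (x, a) \<in> C \<Longrightarrow> cinner x u = a"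
      "(norm u)\<^sup>2 \<le> (norm y)\<^sup>2"
    proof (rule riesz_on_graph[of C "(norm y)\<^sup>2"])
      show "(0, 0) \<in> C"
        unfolding C_def by (rule image_eqI[of _ _ "[]"]) (auto simp: cinner.zero_left)
      fix x a assume xa: "(x, a) \<in> C"
      then obtain zs where zs: "snd ` set zs \<subseteq> S" "x = lincomb w zs" "a = cinner (lincomb v zs) y"
        by (auto simp: C_def)
      show "(scaleC c x, c * a) \<in> C" for c
        unfolding C_def using zs
        by (intro image_eqI[of _ _ "map (\<lambda>(d, x). (c * d, x)) zs"])
          (auto simp: lincomb_scale cinner_scaleC_left)
      show "2 * Re a \<le> (norm y)\<^sup>2 + (norm x)\<^sup>2"
        using Re_cinner_bound[of "lincomb v zs" y] by (simp add: zs norm_eq)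
      fix x' a' assume "(x', a') \<in> C"
      then obtain ws where ws: "snd ` set ws \<subseteq> S" "x' = lincomb w ws" "a' = cinner (lincomb v ws) y"
        by (auto simp: C_def)
      show "(x + x', a + a') \<in> C"
        unfolding C_def using zs ws
        by (intro image_eqI[of _ _ "zs @ ws"]) (auto simp: cinner_add_left)
    qed blast
    have "fst ` C \<subseteq> complex_vector.span (w ` S)"
      by (auto simp: C_def intro: lincomb_in_span)
    then have "u \<in> closed_cspan (w ` S)"
      using u(1) closure_mono unfolding closed_cspan_def by blast
    moreover have "cinner (w x) u = cinner (v x) y" if "x \<in> S" for x
    proof (rule u(2))
      show "(w x, cinner (v x) y) \<in> C"
        unfolding C_def using that by (intro image_eqI[of _ _ "[(1, x)]"]) (auto simp: scaleC_one)
    qed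
    moreover have "norm u \<le> norm y"
      using u(3) by (simp add: power2_le_iff_abs_le)
    ultimately show ?thesis by blast
  qed
  then obtain V where V: "\<And>y. V y \<in> closed_cspan (w ` S)"
    "\<And>x y. x \<in> S \<Longrightarrow> cinner (w x) (V y) = cinner (v x) y" "\<And>y. norm (V y) \<le> norm y"
    by metis
  have eqI: "V y = u" if "u \<in> closed_cspan (w ` S)" "\<And>x. x \<in> S \<Longrightarrow> cinner (w x) u = cinner (v x) y"
    for y u
    by (rule closed_cspan_eqI[of _ "w ` S"]) (auto simp: V that)
  show ?thesis
  proof (intro exI[of _ V] conjI allI ballI)
    show "bounded_clinear V"
    proof (rule bounded_clinearI[where K = 1])
      show "V (x + y) = V x + V y" for x y
        by (rule eqI) (auto simp: V cinner_add_right intro!: closed_cspan_intros)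
      show "V (scaleC c x) = scaleC c (V x)" for c x
        by (rule eqI) (auto simp: V cinner_scaleC_right intro!: closed_cspan_intros)
    qed (simp add: V)
    show "V (v x) = w x" if "x \<in> S" for x
      using that by (intro eqI) (auto simp: gram intro!: closed_cspan_base)
  qed (simp_all add: V)
qed

text \<open>
  Translation along the action preserves the Gram kernel, so each \<open>act t\<close> induces a partial
  isometry on the closed span of \<open>v\<close>; it is completed by the identity on the orthogonal
  complement. The group law holds on the total set \<open>range v \<union> W\<close>, hence everywhere. Since every
  \<open>U t\<close> is a contraction with the contractive inverse \<open>U (- t)\<close>, it is isometric and onto.
\<close>

lemma unitary_group_from_action:
  fixes v :: "'x \<Rightarrow> 'h::complex_hilbert_space" and act :: "real \<Rightarrow> 'x \<Rightarrow> 'x"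
  assumes act_0: "\<And>x. act 0 x = x" and act_add: "\<And>s t x. act (s + t) x = act s (act t x)"
    and gram: "\<And>t x y. cinner (v (act t x)) (v (act t y)) = cinner (v x) (v y)"
    and cont: "\<And>x. continuous_on UNIV (\<lambda>t. v (act t x))"
  obtains U where "unitary_representation U" "\<And>t x. U t (v x) = v (act t x)"
    "\<And>t y. (\<And>x. cinner (v x) y = 0) \<Longrightarrow> U t y = y"
proof -
  have "\<exists>V. bounded_clinear V \<and> (\<forall>y. norm (V y) \<le> norm y) \<and> (\<forall>x. V (v x) = v (act t x)) \<and>
      (\<forall>y. V y \<in> closed_cspan (range v)) \<and> (\<forall>x y. cinner (v (act t x)) (V y) = cinner (v x) y)" for t
  proof -
    have "range (\<lambda>x. v (act t x)) \<subseteq> range v" by auto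
    then have "closed_cspan (range (\<lambda>x. v (act t x))) \<subseteq> closed_cspan (range v)"
      by (rule closed_cspan_mono)
    moreover have "\<forall>x\<in>UNIV. \<forall>y\<in>UNIV. cinner (v (act t x)) (v (act t y)) = cinner (v x) (v y)"
      by (simp add: gram)
    note gram_transport[OF this]
    ultimately show ?thesis by blast
  qed
  then obtain V where V: "\<And>t. bounded_clinear (V t)" "\<And>t y. norm (V t y) \<le> norm y"
    "\<And>t x. V t (v x) = v (act t x)" "\<And>t y. V t y \<in> closed_cspan (range v)"
    "\<And>t x y. cinner (v (act t x)) (V t y) = cinner (v x) y"
    by metis
  define P where "P = V 0"
  have P: "bounded_clinear P" "\<And>x. P (v x) = v x" "\<And>y. P y \<in> closed_cspan (range v)"
    "\<And>x y. cinner (v x) (P y) = cinner (v x) y"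
    using V[where t = 0] by (simp_all add: P_def act_0)
  define W where "W = {y. \<forall>x. cinner (v x) y = 0}"
  have compl: "y - P y \<in> W" for y
    by (simp add: W_def cinner.diff_right P)
  have V_compl: "V t y = 0" if "y \<in> W" for t y
  proof (rule closed_cspan_eqI)
    show "V t y \<in> closed_cspan (range v)" by (rule V)
    show "cinner a (V t y) = cinner a 0" if "a \<in> range v" for a
    proof -
      from that obtain x where "a = v x" by blast
      then have "a = v (act t (act (- t) x))" by (simp add: act_add[symmetric] act_0)
      then show ?thesis using \<open>y \<in> W\<close> by (simp add: V W_def cinner.zero_right)
    qed
  qed (rule closed_cspan_intros)
  define U where "U t y = V t y + (y - P y)" for t y
  have U_v: "U t (v x) = v (act t x)" for t x
    by (simp add: U_def V P)
  have U_W: "U t y = y" if "y \<in> W" for t y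
    using that V_compl by (simp add: U_def P_def)
  have U_contr: "norm (U t y) \<le> norm y" for t y
  proof -
    have orth: "cinner z (y - P y) = 0" if "z \<in> closed_cspan (range v)" for z
      using closed_cspan_orthogonal[OF that, of "y - P y"] compl[of y] by (auto simp: W_def)
    have "V t y = V t (P y)"
      using V_compl[OF compl, of t y] by (simp add: bounded_clinear_diff[OF V(1)])
    then have "norm (V t y) \<le> norm (P y)" using V(2) by metis
    then have "(norm (V t y))\<^sup>2 \<le> (norm (P y))\<^sup>2" by (simp add: power_mono)
    then have "(norm (U t y))\<^sup>2 \<le> (norm (P y + (y - P y)))\<^sup>2"
      unfolding U_def by (simp only: norm_add_square orth[OF V(4)] orth[OF P(3)])
    then show ?thesis by (simp add: power2_le_iff_abs_le)
  qed
  have U_lin: "bounded_clinear (U t)" for t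
  proof (rule bounded_clinearI[where K = 1])
    show "norm (U t x) \<le> 1 * norm x" for x using U_contr by simp
  qed (simp_all add: U_def bounded_clinear_add V P bounded_clinear_scaleC
        scaleC_add_right complex_vector.scale_right_diff_distrib)
  have total: "y \<in> closed_cspan (range v \<union> W)" for y
  proof -
    have "P y \<in> closed_cspan (range v \<union> W)"
      using P(3) closed_cspan_mono[of "range v" "range v \<union> W"] by blast
    moreover have "y - P y \<in> closed_cspan (range v \<union> W)"
      using compl by (intro closed_cspan_base) auto
    ultimately have "P y + (y - P y) \<in> closed_cspan (range v \<union> W)"
      by (rule closed_cspan_intros)
    then show ?thesis by simp
  qed
  have U_0: "U 0 y = y" for y
    by (simp add: U_def P_def)
  have U_add: "U (s + t) y = U s (U t y)" for s t y
    by (rule bounded_clinear_eq_on_closed_cspan[OF U_lin bounded_clinear_compose[OF U_lin U_lin] _ total])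
      (auto simp: U_v U_W act_add)
  have U_iso: "norm (U t y) = norm y" for t y
    using U_contr[of t y] U_contr[of "- t" "U t y"] by (simp add: U_add[symmetric] U_0)
  have "U t (U (- t) y) = y" for t y
    by (simp add: U_add[symmetric] U_0)
  then have "surj (U t)" for t by (metis surj_def)
  then have "unitary (U t)" for t
    by (simp add: unitary_def U_lin isometry_preserves_cinner[OF U_lin U_iso])
  moreover have "continuous_on UNIV (\<lambda>t. U t y)" for y
    by (rule strongly_continuous_on_closed_cspan[OF U_lin U_contr _ total])
      (auto simp: U_v U_W cont)
  ultimately have "unitary_representation U"
    by (auto simp: unitary_representation_def U_0 U_add)
  with that U_v U_W show ?thesis by (simp add: W_def)
qed

section \<open>Realizing positive semidefinite kernels\<close>

definition psd_kernel :: "('x \<Rightarrow> 'x \<Rightarrow> complex) \<Rightarrow> bool" where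
  "psd_kernel k \<longleftrightarrow> (\<forall>x y. k x y = cnj (k y x)) \<and> (\<forall>zs. 0 \<le> Re (form k zs zs))"

text \<open>
  The form at \<open>(- 1, x) # zs\<close> is the squared distance between the point \<open>x\<close> and the combination
  \<open>zs\<close> in the semi-inner product defined by \<open>k\<close>.
\<close>

definition approximable :: "('x \<Rightarrow> 'x \<Rightarrow> complex) \<Rightarrow> 'x set \<Rightarrow> 'x \<Rightarrow> bool" where
  "approximable k S x \<longleftrightarrow>
     (\<forall>\<epsilon>>0. \<exists>zs. snd ` set zs \<subseteq> S \<and> Re (form k ((- 1, x) # zs) ((- 1, x) # zs)) < \<epsilon>)"

lemma approximable_mono: "approximable k S x \<Longrightarrow> S \<subseteq> S' \<Longrightarrow> approximable k S' x"
  unfolding approximable_def by (meson subset_trans)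

lemma Re_form_Cons:
  assumes herm: "\<And>x y. k x y = cnj (k y x)"
  shows "Re (form k ((c, x) # zs) ((c, x) # zs))
    = (cmod c)\<^sup>2 * Re (k x x) + 2 * Re (\<Sum>(d, y)\<leftarrow>zs. d * cnj c * k y x) + Re (form k zs zs)"
proof -
  have "(\<Sum>(d, y)\<leftarrow>zs. c * cnj d * k x y) = cnj (\<Sum>(d, y)\<leftarrow>zs. d * cnj c * k y x)"
  proof (induction zs)
    case (Cons z zs)
    then show ?case using herm[of x "snd z"] by (cases z) (simp add: mult.commute)
  qed simp
  moreover have "Re (c * cnj c * k x x) = (cmod c)\<^sup>2 * Re (k x x)"
    by (simp add: mult_cnj_cmod flip: of_real_power)
  ultimately show ?thesis
    by (simp add: form_Cons_right)
qed

text \<open>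
  Here \<open>u\<close> is the orthogonal projection onto \<open>closed_cspan (v ` S)\<close> of the vector that is still to
  be placed at \<open>x\<close>. Positivity of the form at \<open>(- 1, x) # zs\<close> is exactly the bound needed for
  the functional \<open>v y \<mapsto> k y x\<close>. The defect \<open>k x x - \<parallel>u\<parallel>\<^sup>2\<close> is the squared distance from \<open>x\<close> to
  the combinations of \<open>S\<close>, so it vanishes when \<open>x\<close> is approximable.
\<close>

lemma one_point_extension:
  fixes v :: "'x \<Rightarrow> 'h::complex_hilbert_space"
  assumes psd: "psd_kernel k" and gram: "gram_on k v S"
  obtains u where "u \<in> closed_cspan (v ` S)" "\<And>y. y \<in> S \<Longrightarrow> cinner (v y) u = k y x"
    "(norm u)\<^sup>2 \<le> Re (k x x)" "approximable k S x \<Longrightarrow> (norm u)\<^sup>2 = Re (k x x)"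
proof -
  define ev where "ev zs = (\<Sum>(c, y)\<leftarrow>zs. c * k y x)" for zs
  define C where "C = (\<lambda>zs. (lincomb v zs, ev zs)) ` {zs. snd ` set zs \<subseteq> S}"
  have form: "Re (form k ((- 1, x) # zs) ((- 1, x) # zs))
      = Re (k x x) - 2 * Re (ev zs) + (norm (lincomb v zs))\<^sup>2" if "snd ` set zs \<subseteq> S" for zs
  proof -
    have "(\<Sum>(d, y)\<leftarrow>zs. d * cnj (- 1) * k y x) = - ev zs"
      unfolding ev_def by (induction zs) auto
    moreover have "form k zs zs = complex_of_real ((norm (lincomb v zs))\<^sup>2)"
      by (simp only: form_gram[OF gram that that] cinner_self)
    moreover have "Re (form k ((- 1, x) # zs) ((- 1, x) # zs)) = (cmod (- 1))\<^sup>2 * Re (k x x)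
        + 2 * Re (\<Sum>(d, y)\<leftarrow>zs. d * cnj (- 1) * k y x) + Re (form k zs zs)"
      by (rule Re_form_Cons) (use psd in \<open>unfold psd_kernel_def, blast\<close>)
    ultimately show ?thesis by simp
  qed
  obtain u where u: "u \<in> closure (fst ` C)" "\<And>w a. (w, a) \<in> C \<Longrightarrow> cinner w u = a"
    "(norm u)\<^sup>2 \<le> Re (k x x)"
  proof (rule riesz_on_graph[of C "Re (k x x)"])
    show "(0, 0) \<in> C"
      unfolding C_def by (rule image_eqI[of _ _ "[]"]) (auto simp: ev_def)
    fix w a assume "(w, a) \<in> C"
    then obtain zs where zs: "snd ` set zs \<subseteq> S" "w = lincomb v zs" "a = ev zs"
      by (auto simp: C_def)
    have ev_scale: "ev (map (\<lambda>(d, x). (c * d, x)) zs) = c * ev zs" for c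
      unfolding ev_def by (induction zs) (auto simp: algebra_simps)
    show "(scaleC c w, c * a) \<in> C" for c
      unfolding C_def using zs
      by (intro image_eqI[of _ _ "map (\<lambda>(d, x). (c * d, x)) zs"])
        (auto simp: lincomb_scale ev_scale)
    have "0 \<le> Re (form k ((- 1, x) # zs) ((- 1, x) # zs))"
      using psd unfolding psd_kernel_def by blast
    then show "2 * Re a \<le> Re (k x x) + (norm w)\<^sup>2"
      using form[OF zs(1)] zs by simp
    fix w' a' assume "(w', a') \<in> C"
    then obtain ws where ws: "snd ` set ws \<subseteq> S" "w' = lincomb v ws" "a' = ev ws"
      by (auto simp: C_def)
    show "(w + w', a + a') \<in> C"
      unfolding C_def using zs ws
      by (intro image_eqI[of _ _ "zs @ ws"]) (auto simp: ev_def)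
  qed blast
  show ?thesis
  proof (rule that[OF _ _ u(3)])
    have "fst ` C \<subseteq> complex_vector.span (v ` S)"
      by (auto simp: C_def intro: lincomb_in_span)
    then show "u \<in> closed_cspan (v ` S)"
      using u(1) closure_mono unfolding closed_cspan_def by blast
    show "cinner (v y) u = k y x" if "y \<in> S" for y
    proof (rule u(2))
      show "(v y, k y x) \<in> C"
        unfolding C_def using that
        by (intro image_eqI[of _ _ "[(1, y)]"]) (auto simp: scaleC_one ev_def)
    qed
    assume approx: "approximable k S x"
    have "Re (k x x) \<le> (norm u)\<^sup>2 + \<epsilon>" if "\<epsilon> > 0" for \<epsilon>
    proof -
      obtain zs where zs: "snd ` set zs \<subseteq> S" "Re (form k ((- 1, x) # zs) ((- 1, x) # zs)) < \<epsilon>"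
        using approx \<open>\<epsilon> > 0\<close> unfolding approximable_def by blast
      have "cinner (lincomb v zs) u = ev zs"
        by (rule u(2)) (use zs in \<open>auto simp: C_def\<close>)
      then show ?thesis
        using zs(2) form[OF zs(1)] Re_cinner_bound[of "lincomb v zs" u] by simp
    qed
    then have "Re (k x x) \<le> (norm u)\<^sup>2" by (rule field_le_epsilon)
    with u(3) show "(norm u)\<^sup>2 = Re (k x x)" by simp
  qed
qed

text \<open>
  A transfinite Cholesky decomposition: each new point receives its projection onto the vectors
  already placed, plus a multiple of its own fresh direction \<open>e x\<close> to make up the missing norm.
  The fresh directions are prescribed so that the vectors stay in a controlled subspace of the
  given space; a point at distance \<open>0\<close> from the combinations of earlier ones consumes none. Zorn's
  lemma is applied to graphs of partial realizations, which are single-valued by themselves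
  because the Gram condition determines the distance between two vectors at the same point.
\<close>

lemma kernel_realization:
  fixes v0 :: "'x \<Rightarrow> 'h::complex_hilbert_space"
  assumes psd: "psd_kernel k" and gram0: "gram_on k v0 S0" and sub: "S0 \<subseteq> X"
    and v0: "\<And>x. x \<in> S0 \<Longrightarrow> v0 x \<in> closed_cspan A"
    and e_A: "\<And>x a. x \<in> X - S0 \<Longrightarrow> a \<in> A \<Longrightarrow> cinner a (e x) = 0"
    and e_e: "\<And>x y. x \<in> X - S0 \<Longrightarrow> y \<in> X - S0 \<Longrightarrow> x \<noteq> y \<Longrightarrow> cinner (e y) (e x) = 0"
    and room: "\<And>x. x \<in> X - S0 \<Longrightarrow> norm (e x) = 1 \<or> approximable k S0 x"
  obtains v where "\<And>x. x \<in> S0 \<Longrightarrow> v x = v0 x" "gram_on k v X"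
    "\<And>x. x \<in> X \<Longrightarrow> v x \<in> closed_cspan (A \<union> e ` (X - S0))"
proof -
  have herm: "k x y = cnj (k y x)" for x y
    using psd unfolding psd_kernel_def by blast
  define G0 where "G0 = (\<lambda>x. (x, v0 x)) ` S0"
  define Z where "Z = {G. G0 \<subseteq> G \<and> fst ` G \<subseteq> X \<and>
      (\<forall>(x, g)\<in>G. \<forall>(y, h)\<in>G. cinner g h = k x y) \<and>
      (\<forall>(x, g)\<in>G. g \<in> closed_cspan (A \<union> e ` (fst ` G - S0)))}"
  have "\<exists>M\<in>Z. \<forall>G\<in>Z. M \<subseteq> G \<longrightarrow> G = M"
  proof (rule subset_Zorn_nonempty)
    have "\<forall>x\<in>S0. v0 x \<in> closed_cspan (A \<union> e ` (fst ` G0 - S0))"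
      using v0 closed_cspan_mono[of A] by blast
    then have "G0 \<in> Z"
      using gram0 sub by (auto simp: Z_def G0_def gram_on_def)
    then show "Z \<noteq> {}" by blast
    fix \<C> assume ne: "\<C> \<noteq> {}" and "subset.chain Z \<C>"
    then have in_Z: "\<C> \<subseteq> Z" and chain: "\<And>G H. G \<in> \<C> \<Longrightarrow> H \<in> \<C> \<Longrightarrow> G \<subseteq> H \<or> H \<subseteq> G"
      by (auto simp: subset.chain_def)
    show "\<Union>\<C> \<in> Z"
      unfolding Z_def
    proof (intro CollectI conjI)
      have "G0 \<subseteq> G \<and> fst ` G \<subseteq> X" if "G \<in> \<C>" for G
        using in_Z that unfolding Z_def by blast
      then show "G0 \<subseteq> \<Union>\<C>" "fst ` \<Union>\<C> \<subseteq> X"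
        using ne by blast+
      show "\<forall>(x, g)\<in>\<Union>\<C>. \<forall>(y, h)\<in>\<Union>\<C>. cinner g h = k x y"
      proof (clarify)
        fix x g y h G H assume *: "(x, g) \<in> G" "G \<in> \<C>" "(y, h) \<in> H" "H \<in> \<C>"
        then obtain K where "K \<in> \<C>" "(x, g) \<in> K" "(y, h) \<in> K"
          using chain[of G H] by blast
        then show "cinner g h = k x y"
          using in_Z unfolding Z_def by blast
      qed
      show "\<forall>(x, g)\<in>\<Union>\<C>. g \<in> closed_cspan (A \<union> e ` (fst ` \<Union>\<C> - S0))"
      proof (clarify)
        fix x g G assume *: "(x, g) \<in> G" "G \<in> \<C>"
        then have "g \<in> closed_cspan (A \<union> e ` (fst ` G - S0))"
          using in_Z unfolding Z_def by blast
        moreover have "A \<union> e ` (fst ` G - S0) \<subseteq> A \<union> e ` (fst ` \<Union>\<C> - S0)"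
          using * by auto
        ultimately show "g \<in> closed_cspan (A \<union> e ` (fst ` \<Union>\<C> - S0))"
          using closed_cspan_mono by blast
      qed
    qed
  qed
  then obtain M where "M \<in> Z" and max: "\<And>G. G \<in> Z \<Longrightarrow> M \<subseteq> G \<Longrightarrow> G = M" by blast
  from \<open>M \<in> Z\<close> have M: "G0 \<subseteq> M" "fst ` M \<subseteq> X"
    "\<And>x g y h. (x, g) \<in> M \<Longrightarrow> (y, h) \<in> M \<Longrightarrow> cinner g h = k x y"
    "\<And>x g. (x, g) \<in> M \<Longrightarrow> g \<in> closed_cspan (A \<union> e ` (fst ` M - S0))"
    unfolding Z_def by blast+
  define S where "S = fst ` M"
  define v where "v x = (SOME g. (x, g) \<in> M)" for x
  have v_M: "(x, v x) \<in> M" if "x \<in> S" for x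
    using that unfolding S_def v_def by (metis imageE prod.collapse someI_ex)
  have gram: "gram_on k v S"
    using M(3) v_M by (auto simp: gram_on_def)
  have v_unique: "g = v x" if "(x, g) \<in> M" for x g
  proof -
    have "(x, v x) \<in> M" using that v_M[of x] by (force simp: S_def)
    then have "cinner (g - v x) (g - v x) = 0"
      using that M(3) by (simp add: cinner.diff_left cinner.diff_right)
    then show ?thesis by (simp add: cinner_self_eq_0)
  qed
  have S0_S: "S0 \<subseteq> S" using M(1) by (force simp: G0_def S_def)
  have "S = X"
  proof (rule ccontr)
    assume "S \<noteq> X"
    then obtain x where x: "x \<in> X" "x \<notin> S" using M(2) S_def by blast
    then have xX: "x \<in> X - S0" using S0_S by blast
    obtain u where u: "u \<in> closed_cspan (v ` S)" "\<And>y. y \<in> S \<Longrightarrow> cinner (v y) u = k y x"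
      "(norm u)\<^sup>2 \<le> Re (k x x)" "approximable k S x \<Longrightarrow> (norm u)\<^sup>2 = Re (k x x)"
      using one_point_extension[OF psd gram, of x] by blast
    define c where "c = sqrt (Re (k x x) - (norm u)\<^sup>2)"
    define h where "h = u + scaleC (complex_of_real c) (e x)"
    have M_sub: "v ` S \<subseteq> closed_cspan (A \<union> e ` (S - S0))"
      using M(4) v_M by (auto simp: S_def)
    have orth: "cinner g (e x) = 0" if "g \<in> closed_cspan (A \<union> e ` (S - S0))" for g
    proof (rule closed_cspan_orthogonal[OF that])
      fix a assume "a \<in> A \<union> e ` (S - S0)"
      then consider "a \<in> A" | y where "y \<in> S - S0" "a = e y" by blast
      then show "cinner a (e x) = 0"
      proof cases
        case 2
        then have "y \<in> X - S0" "x \<noteq> y" using x M(2) by (auto simp: S_def)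
        then show ?thesis using e_e[OF xX] 2 by simp
      qed (rule e_A[OF xX])
    qed
    have u': "u \<in> closed_cspan (A \<union> e ` (S - S0))"
      using u(1) closed_cspan_subset[OF M_sub] by blast
    have c: "c\<^sup>2 * (norm (e x))\<^sup>2 = Re (k x x) - (norm u)\<^sup>2"
      using room[OF xX]
    proof
      assume "approximable k S0 x"
      then have "(norm u)\<^sup>2 = Re (k x x)" by (intro u(4) approximable_mono[OF _ S0_S])
      then show ?thesis by (simp add: c_def)
    qed (use u(3) in \<open>simp add: c_def\<close>)
    have gh: "cinner g h = k y x" if "(y, g) \<in> M" for y g
    proof -
      have "cinner g (e x) = 0"
        using M(4)[OF that] by (intro orth) (simp add: S_def)
      moreover have "y \<in> S" using that by (force simp: S_def)
      ultimately show ?thesis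
        using u(2)[of y] v_unique[OF that] by (simp add: h_def cinner_add_right cinner_scaleC_right)
    qed
    have "(norm h)\<^sup>2 = (norm u)\<^sup>2 + c\<^sup>2 * (norm (e x))\<^sup>2"
      by (simp add: h_def norm_add_square cinner_scaleC_right orth[OF u'] norm_scaleC power_mult_distrib)
    then have "(norm h)\<^sup>2 = Re (k x x)" using c by simp
    moreover have "Im (k x x) = 0" using arg_cong[OF herm[of x x], of Im] by simp
    ultimately have hh: "cinner h h = k x x"
      by (simp add: cinner_self complex_eq_iff del: of_real_power)
    have hg: "cinner h g = k x y" if "(y, g) \<in> M" for y g
      by (metis cinner_commute gh[OF that] herm)
    have bigger: "A \<union> e ` (S - S0) \<subseteq> A \<union> e ` (insert x S - S0)" by blast
    have "h \<in> closed_cspan (A \<union> e ` (insert x S - S0))"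
      unfolding h_def
    proof (intro closed_cspan_intros(2,4))
      show "u \<in> closed_cspan (A \<union> e ` (insert x S - S0))"
        using u' closed_cspan_mono[OF bigger] by blast
      show "e x \<in> closed_cspan (A \<union> e ` (insert x S - S0))"
        using xX by (intro closed_cspan_base) auto
    qed
    moreover have "g \<in> closed_cspan (A \<union> e ` (insert x S - S0))" if "(y, g) \<in> M" for y g
      using M(4)[OF that] closed_cspan_mono[OF bigger] by (auto simp: S_def)
    ultimately have range: "\<forall>(y, g)\<in>insert (x, h) M.
        g \<in> closed_cspan (A \<union> e ` (fst ` insert (x, h) M - S0))"
      by (auto simp: S_def)
    have "\<forall>(y, g)\<in>insert (x, h) M. \<forall>(z, l)\<in>insert (x, h) M. cinner g l = k y z"
      using M(3) gh hg hh by blast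
    with range have "insert (x, h) M \<in> Z"
      using M(1,2) x(1) unfolding Z_def by auto
    then have "(x, h) \<in> M" using max by blast
    then show False using x(2) by (force simp: S_def)
  qed
  show ?thesis
  proof (rule that)
    show "v x = v0 x" if "x \<in> S0" for x
      using that M(1) v_unique[of x "v0 x"] by (auto simp: G0_def)
    show "gram_on k v X" using gram \<open>S = X\<close> by simp
    show "v x \<in> closed_cspan (A \<union> e ` (X - S0))" if "x \<in> X" for x
      using M(4)[of x "v x"] v_M that \<open>S = X\<close> by (simp add: S_def)
  qed
qed

lemma kernel_realization_approximable:
  fixes v0 :: "'x \<Rightarrow> 'h::complex_hilbert_space"
  assumes "psd_kernel k" "gram_on k v0 S0" "S0 \<subseteq> X"
    and v0: "\<And>x. x \<in> S0 \<Longrightarrow> v0 x \<in> closed_cspan A"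
    and "\<And>x. x \<in> X \<Longrightarrow> approximable k S0 x"
  obtains v where "\<And>x. x \<in> S0 \<Longrightarrow> v x = v0 x" "gram_on k v X" "\<And>x. x \<in> X \<Longrightarrow> v x \<in> closed_cspan A"
proof -
  have "closed_cspan (A \<union> (\<lambda>_. 0) ` (X - S0)) \<subseteq> closed_cspan A"
    using closed_cspan_superset[of A] by (intro closed_cspan_subset) (auto intro: closed_cspan_intros)
  moreover obtain v where "\<And>x. x \<in> S0 \<Longrightarrow> v x = v0 x" "gram_on k v X"
      "\<And>x. x \<in> X \<Longrightarrow> v x \<in> closed_cspan (A \<union> (\<lambda>_. 0) ` (X - S0))"
    using kernel_realization[OF assms(1-4), of "\<lambda>_. 0"] assms(5)
    by (auto simp: cinner.zero_right)
  ultimately show ?thesis using that by blast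
qed

section \<open>The dilation kernel of a contraction semigroup\<close>

text \<open>
  The kernel \<open>\<langle>T(s - t) \<xi>, \<eta>\<rangle>\<close> of Sz.-Nagy's dilation theorem, with \<open>T(- r)\<close> read as the adjoint of
  \<open>T(r)\<close>. Moving the operator to the later of the two points expresses it without adjoints.
\<close>

definition dilation_kernel ::
    "(real \<Rightarrow> 'h::complex_hilbert_space \<Rightarrow> 'h) \<Rightarrow> real \<times> 'h \<Rightarrow> real \<times> 'h \<Rightarrow> complex" where
  "dilation_kernel T x y =
     (if fst y \<le> fst x then cinner (T (fst x - fst y) (snd x)) (snd y)
      else cinner (snd x) (T (fst y - fst x) (snd y)))"

lemma dilation_kernel_later:
  "t \<le> s \<Longrightarrow> dilation_kernel T (s, \<xi>) (t, \<eta>) = cinner (T (s - t) \<xi>) \<eta>"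
  by (simp add: dilation_kernel_def)

lemma dilation_kernel_shift:
  "dilation_kernel T (s + r, \<xi>) (t + r, \<eta>) = dilation_kernel T (s, \<xi>) (t, \<eta>)"
  by (simp add: dilation_kernel_def)

lemma form_permute:
  fixes zs ws :: "(complex \<times> 'x) list"
  shows "mset zs = mset ws \<Longrightarrow> form k zs zs = form k ws ws"
proof -
  assume eq: "mset zs = mset ws"
  have sums: "sum_list (map f zs) = sum_list (map f ws)" for f :: "complex \<times> 'x \<Rightarrow> complex"
    by (metis eq mset_map sum_mset_sum_list)
  show ?thesis unfolding form_def using sums by (simp add: case_prod_unfold)
qed

lemma span_imp_lincomb:
  assumes "p \<in> complex_vector.span (v ` S)"
  obtains zs where "snd ` set zs \<subseteq> S" "p = lincomb v zs"
proof -
  let ?L = "lincomb v ` {zs. snd ` set zs \<subseteq> S}"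
  have "complex_vector.span (v ` S) \<subseteq> ?L"
  proof (rule complex_vector.span_minimal[OF _ complex_vector.subspaceI])
    show "v ` S \<subseteq> ?L"
    proof
      fix p assume "p \<in> v ` S"
      then obtain x where "x \<in> S" "p = v x" by blast
      then show "p \<in> ?L"
        by (intro image_eqI[of _ _ "[(1, x)]"]) (auto simp: scaleC_one)
    qed
    show "0 \<in> ?L" by (rule image_eqI[of _ _ "[]"]) auto
    fix p q assume "p \<in> ?L" "q \<in> ?L"
    then obtain zs ws where "snd ` set zs \<subseteq> S" "p = lincomb v zs" "snd ` set ws \<subseteq> S" "q = lincomb v ws"
      by blast
    then show "p + q \<in> ?L"
      by (intro image_eqI[of _ _ "zs @ ws"]) auto
  next
    fix c p assume "p \<in> ?L"
    then obtain zs where "snd ` set zs \<subseteq> S" "p = lincomb v zs" by blast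
    then show "scaleC c p \<in> ?L"
      by (intro image_eqI[of _ _ "map (\<lambda>(d, x). (c * d, x)) zs"]) (auto simp: lincomb_scale)
  qed
  with assms that show ?thesis by blast
qed

context
  fixes T :: "real \<Rightarrow> 'h::complex_hilbert_space \<Rightarrow> 'h"
  assumes T: "contractive_C0_semigroup T"
begin

lemma semigroup_linear: "0 \<le> t \<Longrightarrow> bounded_clinear (T t)"
  using T by (simp add: contractive_C0_semigroup_def)

lemma semigroup_zero: "T 0 \<xi> = \<xi>"
  using T by (simp add: contractive_C0_semigroup_def)

lemma semigroup_add: "0 \<le> s \<Longrightarrow> 0 \<le> t \<Longrightarrow> T (s + t) \<xi> = T s (T t \<xi>)"
  using T by (simp add: contractive_C0_semigroup_def)

lemma semigroup_contractive: "0 \<le> t \<Longrightarrow> norm (T t \<xi>) \<le> norm \<xi>"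
proof -
  assume "0 \<le> t"
  then have "bounded_linear (T t)" "onorm (T t) \<le> 1"
    using T by (auto simp: contractive_C0_semigroup_def bounded_clinear_def)
  then have "norm (T t \<xi>) \<le> onorm (T t) * norm \<xi>" "onorm (T t) * norm \<xi> \<le> 1 * norm \<xi>"
    by (intro onorm mult_right_mono; simp)+
  then show ?thesis by linarith
qed

text \<open>
  The quantity bounded here is \<open>\<parallel>v(s + t, \<xi>) - v(s, \<xi>)\<parallel>\<^sup>2\<close> for any vectors \<open>v\<close> that realize the
  dilation kernel.
\<close>

lemma semigroup_small_time:
  assumes "\<epsilon> > 0"
  shows "\<exists>\<delta>>0. \<forall>t\<ge>0. t < \<delta> \<longrightarrow> 2 * (norm \<xi>)\<^sup>2 - 2 * Re (cinner (T t \<xi>) \<xi>) < \<epsilon>"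
proof -
  define f where "f t = 2 * (norm \<xi>)\<^sup>2 - 2 * Re (cinner (T t \<xi>) \<xi>)" for t
  have "continuous_on {0..} (\<lambda>t. T t \<xi>)"
    using T by (simp add: contractive_C0_semigroup_def)
  then have "continuous_on {0..} f"
    unfolding f_def by (intro continuous_intros cinner.continuous_on)
  moreover have "f 0 = 0"
    by (simp add: f_def semigroup_zero cinner_self)
  ultimately obtain \<delta> where "\<delta> > 0" "\<And>t. 0 \<le> t \<Longrightarrow> dist t 0 < \<delta> \<Longrightarrow> dist (f t) 0 < \<epsilon>"
    unfolding continuous_on_iff using assms by (metis atLeast_iff order_refl)
  then show ?thesis
    by (intro exI[of _ \<delta>]) (simp add: f_def dist_real_def abs_less_iff)
qed

lemma dilation_kernel_hermitian:
  "dilation_kernel T x y = cnj (dilation_kernel T y x)"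
proof (cases "fst x = fst y")
  case True
  then show ?thesis
    by (simp add: dilation_kernel_def semigroup_zero cinner_commute[of "snd x" "snd y"])
next
  case False
  then show ?thesis
    using cinner_commute[of "T (fst x - fst y) (snd x)" "snd y"]
      cinner_commute[of "snd x" "T (fst y - fst x) (snd y)"]
    by (simp add: dilation_kernel_def)
qed

lemma dilation_kernel_diagonal: "Re (dilation_kernel T (t, \<xi>) (t, \<xi>)) = (norm \<xi>)\<^sup>2"
  by (simp add: dilation_kernel_later semigroup_zero cinner_self)

text \<open>
  Positivity of the kernel, strengthened for an induction over the time points from the latest to
  the earliest. Let \<open>r\<close> be the earliest time, with vector \<open>\<zeta> = c \<xi>\<close>, and let
  \<open>y = \<Sum> d T(t - r) \<eta>\<close> over the later points. The new terms of the form are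
  \<open>\<parallel>\<zeta>\<parallel>\<^sup>2 + 2 Re \<langle>y, \<zeta>\<rangle>\<close>, and the old ones are at least \<open>\<parallel>y\<parallel>\<^sup>2\<close> by induction; together this is
  \<open>\<parallel>y + \<zeta>\<parallel>\<^sup>2\<close>, which only decreases under the contraction \<open>T(r - s)\<close>.
\<close>

lemma dilation_form_sorted:
  assumes "sorted (map (fst \<circ> snd) zs)" "\<And>z. z \<in> set zs \<Longrightarrow> s \<le> fst (snd z)"
  shows "(norm (lincomb (\<lambda>(t, \<xi>). T (t - s) \<xi>) zs))\<^sup>2 \<le> Re (form (dilation_kernel T) zs zs)"
  using assms
proof (induction zs arbitrary: s)
  case (Cons z zs)
  obtain c r \<xi> where z: "z = (c, r, \<xi>)" by (metis prod.exhaust)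
  define y where "y = lincomb (\<lambda>(t, \<xi>). T (t - r) \<xi>) zs"
  have later: "r \<le> fst (snd w)" if "w \<in> set zs" for w
    using Cons.prems(1) that z by auto
  have sr: "s \<le> r" using Cons.prems(2)[of z] z by simp
  have IH: "(norm y)\<^sup>2 \<le> Re (form (dilation_kernel T) zs zs)"
    unfolding y_def by (rule Cons.IH) (use Cons.prems(1) later in auto)
  have cross: "(\<Sum>(d, w)\<leftarrow>zs. d * cnj c * dilation_kernel T w (r, \<xi>)) = cinner y (scaleC c \<xi>)"
    unfolding y_def using later
  proof (induction zs)
    case (Cons w zs)
    obtain d t \<eta> where w: "w = (d, t, \<eta>)" by (metis prod.exhaust)
    then have "r \<le> t" using Cons.prems[of w] by simp
    then show ?case
      using Cons w by (simp add: cinner_add_left cinner_scaleC_left cinner_scaleC_right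
          dilation_kernel_later algebra_simps)
  qed (simp add: cinner.zero_left)
  have "lincomb (\<lambda>(t, \<xi>). T (t - s) \<xi>) zs = T (r - s) y"
    unfolding y_def using later
  proof (induction zs)
    case (Cons w zs)
    obtain d t \<eta> where w: "w = (d, t, \<eta>)" by (metis prod.exhaust)
    then have "r \<le> t" using Cons.prems[of w] by simp
    then have "T (t - s) \<eta> = T (r - s) (T (t - r) \<eta>)"
      using semigroup_add[of "r - s" "t - r" \<eta>] sr by simp
    then show ?case
      using Cons w sr by (simp add: semigroup_linear bounded_clinear_add bounded_clinear_scaleC)
  qed (use sr in \<open>simp add: bounded_clinear_zero semigroup_linear\<close>)
  then have "lincomb (\<lambda>(t, \<xi>). T (t - s) \<xi>) (z # zs) = T (r - s) (scaleC c \<xi> + y)"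
    using sr by (simp add: z semigroup_linear bounded_clinear_add bounded_clinear_scaleC)
  then have "norm (lincomb (\<lambda>(t, \<xi>). T (t - s) \<xi>) (z # zs)) \<le> norm (scaleC c \<xi> + y)"
    using sr by (simp only:) (rule semigroup_contractive, simp)
  then have "(norm (lincomb (\<lambda>(t, \<xi>). T (t - s) \<xi>) (z # zs)))\<^sup>2 \<le> (norm (y + scaleC c \<xi>))\<^sup>2"
    by (simp add: add.commute power_mono)
  also have "\<dots> = (norm y)\<^sup>2 + 2 * Re (cinner y (scaleC c \<xi>)) + (cmod c)\<^sup>2 * (norm \<xi>)\<^sup>2"
    by (simp add: norm_add_square norm_scaleC power_mult_distrib)
  also have "\<dots> \<le> Re (form (dilation_kernel T) (z # zs) (z # zs))"
    unfolding z Re_form_Cons[OF dilation_kernel_hermitian] cross dilation_kernel_diagonal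
    using IH by simp
  finally show ?case .
qed simp

lemma psd_dilation_kernel: "psd_kernel (dilation_kernel T)"
  unfolding psd_kernel_def
proof (intro conjI allI)
  fix zs :: "(complex \<times> real \<times> 'h) list"
  define ws where "ws = sort_key (fst \<circ> snd) zs"
  have "sorted (map (fst \<circ> snd) ws)" by (simp add: ws_def)
  moreover obtain s where "\<forall>z\<in>set ws. s \<le> fst (snd z)"
  proof
    show "\<forall>z\<in>set ws. Min (insert 0 ((fst \<circ> snd) ` set ws)) \<le> fst (snd z)" by auto
  qed
  ultimately have "0 \<le> Re (form (dilation_kernel T) ws ws)"
    using dilation_form_sorted[of ws s] by (meson order_trans zero_le_power2)
  moreover have "form (dilation_kernel T) ws ws = form (dilation_kernel T) zs zs"
    by (rule form_permute) (simp add: ws_def)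
  ultimately show "0 \<le> Re (form (dilation_kernel T) zs zs)" by simp
qed (rule dilation_kernel_hermitian)

text \<open>
  At a fixed time the dilation kernel is the inner product of \<open>H\<close>.
\<close>

lemma approximable_same_time:
  assumes "closed_cspan B = UNIV"
  shows "approximable (dilation_kernel T) ({q} \<times> B) (q, \<xi>)"
  unfolding approximable_def
proof (intro allI impI)
  fix \<epsilon> :: real assume "\<epsilon> > 0"
  have "\<xi> \<in> closure (complex_vector.span (snd ` ({q} \<times> B)))"
    using assms by (simp add: closed_cspan_def)
  then obtain p where "p \<in> complex_vector.span (snd ` ({q} \<times> B))" "dist p \<xi> < sqrt \<epsilon>"
    using \<open>\<epsilon> > 0\<close> closure_approachable by (metis real_sqrt_gt_zero)
  then obtain zs where zs: "snd ` set zs \<subseteq> {q} \<times> B" "dist (lincomb snd zs) \<xi> < sqrt \<epsilon>"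
    by (metis span_imp_lincomb)
  let ?ws = "(- 1, (q, \<xi>)) # zs"
  have "gram_on (dilation_kernel T) snd ({q} \<times> UNIV)"
    by (auto simp: gram_on_def dilation_kernel_later semigroup_zero)
  moreover have sub: "snd ` set ?ws \<subseteq> {q} \<times> UNIV" using zs(1) by auto
  ultimately have "form (dilation_kernel T) ?ws ?ws = cinner (lincomb snd ?ws) (lincomb snd ?ws)"
    by (intro form_gram)
  also have "lincomb snd ?ws = lincomb snd zs - \<xi>"
    by (simp add: scaleC_one)
  finally have "Re (form (dilation_kernel T) ?ws ?ws) = (dist (lincomb snd zs) \<xi>)\<^sup>2"
    by (simp add: cinner_self dist_norm)
  also have "\<dots> < (sqrt \<epsilon>)\<^sup>2"
    by (rule power_strict_mono) (use zs(2) in auto)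
  finally show "\<exists>zs. snd ` set zs \<subseteq> {q} \<times> B \<and>
      Re (form (dilation_kernel T) ((- 1, (q, \<xi>)) # zs) ((- 1, (q, \<xi>)) # zs)) < \<epsilon>"
    using zs(1) \<open>\<epsilon> > 0\<close> by (intro exI[of _ zs]) auto
qed

text \<open>
  A single point \<open>(q, \<xi>)\<close> with \<open>q\<close> close to \<open>s\<close> suffices, by strong continuity.
\<close>

lemma approximable_rational_time:
  "approximable (dilation_kernel T) (\<rat> \<times> UNIV) (s, \<xi>)"
  unfolding approximable_def
proof (intro allI impI)
  fix \<epsilon> :: real assume "\<epsilon> > 0"
  then obtain \<delta> where \<delta>: "\<delta> > 0"
    "\<And>t. 0 \<le> t \<Longrightarrow> t < \<delta> \<Longrightarrow> 2 * (norm \<xi>)\<^sup>2 - 2 * Re (cinner (T t \<xi>) \<xi>) < \<epsilon>"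
    using semigroup_small_time by blast
  obtain q where q: "q \<in> \<rat>" "s < q" "q < s + \<delta>"
    using Rats_dense_in_real[of s "s + \<delta>"] \<delta>(1) by auto
  have "Re (form (dilation_kernel T) [(- 1, (s, \<xi>)), (1, (q, \<xi>))] [(- 1, (s, \<xi>)), (1, (q, \<xi>))])
      = 2 * (norm \<xi>)\<^sup>2 - 2 * Re (cinner (T (q - s) \<xi>) \<xi>)"
    using q(2) unfolding Re_form_Cons[OF dilation_kernel_hermitian] dilation_kernel_diagonal
    by (simp add: dilation_kernel_later)
  also have "\<dots> < \<epsilon>" using q by (intro \<delta>) auto
  finally show "\<exists>zs. snd ` set zs \<subseteq> \<rat> \<times> UNIV \<and>
      Re (form (dilation_kernel T) ((- 1, (s, \<xi>)) # zs) ((- 1, (s, \<xi>)) # zs)) < \<epsilon>"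
    using q(1) by (intro exI[of _ "[(1, (q, \<xi>))]"]) auto
qed

section \<open>The unitary dilation of one semigroup\<close>

text \<open>
  The vectors are placed in three stages, and only the second consumes fresh directions: first the
  copy \<open>J\<close> of \<open>H\<close> at time \<open>0\<close>, then the elements of a total set \<open>B\<close> at rational times, and finally
  everything else, which is approximable by linearity at rational times and by strong
  continuity at the remaining ones. This keeps the number of directions at \<open>\<aleph>\<^sub>0 \<cdot> |B|\<close>.
\<close>

lemma dilation_vectors:
  fixes J :: "'h \<Rightarrow> 'h" and B :: "'h set" and e :: "real \<times> 'h \<Rightarrow> 'h"
  assumes J: "\<And>\<xi> \<eta>. cinner (J \<xi>) (J \<eta>) = cinner \<xi> \<eta>"
    and B: "closed_cspan B = UNIV"
    and e_norm: "\<And>x. x \<in> \<rat> \<times> B \<Longrightarrow> norm (e x) = 1"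
    and e_orth: "\<And>x y. x \<in> \<rat> \<times> B \<Longrightarrow> y \<in> \<rat> \<times> B \<Longrightarrow> x \<noteq> y \<Longrightarrow> cinner (e x) (e y) = 0"
    and e_J: "\<And>x \<xi>. x \<in> \<rat> \<times> B \<Longrightarrow> cinner (J \<xi>) (e x) = 0"
  obtains v where "\<And>\<xi>. v (0, \<xi>) = J \<xi>" "\<And>x y. cinner (v x) (v y) = dilation_kernel T x y"
    "\<And>x. v x \<in> closed_cspan (range J \<union> e ` (\<rat> \<times> B))"
proof -
  note psd = psd_dilation_kernel
  define A where "A = range J \<union> e ` (\<rat> \<times> B)"
  define S0 :: "(real \<times> 'h) set" where "S0 = {0} \<times> UNIV"
  define S1 where "S1 = S0 \<union> \<rat> \<times> B"
  define S2 :: "(real \<times> 'h) set" where "S2 = \<rat> \<times> UNIV"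
  have new: "S1 - S0 \<subseteq> \<rat> \<times> B" by (auto simp: S1_def)
  obtain v1 where v1: "\<And>x. x \<in> S0 \<Longrightarrow> v1 x = J (snd x)" "gram_on (dilation_kernel T) v1 S1"
    "\<And>x. x \<in> S1 \<Longrightarrow> v1 x \<in> closed_cspan (range J \<union> e ` (S1 - S0))"
  proof (rule kernel_realization[OF psd, of "J \<circ> snd" S0 S1 "range J" e])
    show "cinner (e y) (e x) = 0" if "x \<in> S1 - S0" "y \<in> S1 - S0" "x \<noteq> y" for x y
      using that new by (intro e_orth) auto
    show "gram_on (dilation_kernel T) (J \<circ> snd) S0"
      by (auto simp: gram_on_def S0_def dilation_kernel_later semigroup_zero J)
    show "(J \<circ> snd) x \<in> closed_cspan (range J)" for x
      by (auto intro: closed_cspan_base)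
  qed (use new e_norm e_J in \<open>auto simp: S1_def\<close>)
  have "closed_cspan (range J \<union> e ` (S1 - S0)) \<subseteq> closed_cspan A"
    unfolding A_def using new by (intro closed_cspan_mono) auto
  then have v1_A: "v1 x \<in> closed_cspan A" if "x \<in> S1" for x
    using v1(3) that by blast
  have approx1: "approximable (dilation_kernel T) S1 x" if "x \<in> S2" for x
  proof -
    have "approximable (dilation_kernel T) ({fst x} \<times> B) (fst x, snd x)"
      by (rule approximable_same_time[OF B])
    then show ?thesis
      using that by (auto simp: S1_def S2_def elim!: approximable_mono)
  qed
  have S12: "S1 \<subseteq> S2" by (auto simp: S0_def S1_def S2_def)
  obtain v2 where v2: "\<And>x. x \<in> S1 \<Longrightarrow> v2 x = v1 x" "gram_on (dilation_kernel T) v2 S2"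
    "\<And>x. x \<in> S2 \<Longrightarrow> v2 x \<in> closed_cspan A"
    using kernel_realization_approximable[OF psd v1(2) S12 v1_A approx1] by blast
  have approx2: "approximable (dilation_kernel T) S2 x" for x
    using approximable_rational_time[of "fst x" "snd x"] by (simp add: S2_def)
  obtain v where v: "\<And>x. x \<in> S2 \<Longrightarrow> v x = v2 x" "gram_on (dilation_kernel T) v UNIV"
    "\<And>x. v x \<in> closed_cspan A"
  proof (rule kernel_realization_approximable[OF psd v2(2) subset_UNIV])
    show "approximable (dilation_kernel T) S2 x" for x by (rule approx2)
    show "v2 x \<in> closed_cspan A" if "x \<in> S2" for x by (rule v2(3)[OF that])
  qed (rule that; simp)
  show ?thesis
  proof (rule that)
    show "v (0, \<xi>) = J \<xi>" for \<xi>
      using v(1)[of "(0, \<xi>)"] v2(1)[of "(0, \<xi>)"] v1(1)[of "(0, \<xi>)"]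
      by (simp add: S0_def S1_def S2_def)
    show "cinner (v x) (v y) = dilation_kernel T x y" for x y
      using v(2) unfolding gram_on_def by blast
    show "v x \<in> closed_cspan (range J \<union> e ` (\<rat> \<times> B))" for x
      using v(3) by (simp add: A_def)
  qed
qed

text \<open>
  \<open>N\<close> collects the errors \<open>v(t, \<xi>) - J (T t \<xi>)\<close> for \<open>t \<ge> 0\<close>. They are orthogonal to \<open>J H\<close> because
  \<open>\<langle>v(t, \<xi>), v(0, \<eta>)\<rangle> = \<langle>T(t) \<xi>, \<eta>\<rangle>\<close>, and translating an error by a positive time yields a difference
  of two errors. So once a vector has left \<open>J H\<close> towards \<open>N\<close>, nonnegative times never bring it back;
  this is what makes the dilation compatible with products. The group fixes the complement of
  the prescribed subspace, so that dilations of different semigroups can be combined.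
\<close>

lemma unitary_dilation:
  fixes J :: "'h \<Rightarrow> 'h" and B :: "'h set" and e :: "real \<times> 'h \<Rightarrow> 'h"
  assumes J: "\<And>\<xi> \<eta>. cinner (J \<xi>) (J \<eta>) = cinner \<xi> \<eta>"
    and B: "closed_cspan B = UNIV"
    and e_norm: "\<And>x. x \<in> \<rat> \<times> B \<Longrightarrow> norm (e x) = 1"
    and e_orth: "\<And>x y. x \<in> \<rat> \<times> B \<Longrightarrow> y \<in> \<rat> \<times> B \<Longrightarrow> x \<noteq> y \<Longrightarrow> cinner (e x) (e y) = 0"
    and e_J: "\<And>x \<xi>. x \<in> \<rat> \<times> B \<Longrightarrow> cinner (J \<xi>) (e x) = 0"
  obtains U N where "unitary_representation U"
    "\<And>t y. (\<And>a. a \<in> range J \<union> e ` (\<rat> \<times> B) \<Longrightarrow> cinner a y = 0) \<Longrightarrow> U t y = y"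
    "N \<subseteq> closed_cspan (range J \<union> e ` (\<rat> \<times> B))"
    "\<And>n \<xi>. n \<in> N \<Longrightarrow> cinner n (J \<xi>) = 0"
    "\<And>t \<xi>. 0 \<le> t \<Longrightarrow> U t (J \<xi>) - J (T t \<xi>) \<in> N"
    "\<And>t n. 0 \<le> t \<Longrightarrow> n \<in> N \<Longrightarrow> U t n \<in> complex_vector.span N"
proof -
  define A where "A = range J \<union> e ` (\<rat> \<times> B)"
  obtain v where v_0: "\<And>\<xi>. v (0, \<xi>) = J \<xi>"
    and gram: "\<And>x y. cinner (v x) (v y) = dilation_kernel T x y"
    and v_A: "\<And>x. v x \<in> closed_cspan A"
    by (rule dilation_vectors[OF J B], (rule e_norm e_orth e_J; assumption)+, (rule that; simp add: A_def))
  define act :: "real \<Rightarrow> real \<times> 'h \<Rightarrow> real \<times> 'h" where "act r x = (fst x + r, snd x)" for r x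
  have cont: "continuous_on UNIV (\<lambda>t. v (act t x))" for x
    unfolding continuous_on_iff
  proof (intro ballI allI impI)
    fix t \<epsilon> :: real assume "\<epsilon> > 0"
    obtain s \<xi> where x: "x = (s, \<xi>)" by force
    have "0 < \<epsilon>\<^sup>2" using \<open>\<epsilon> > 0\<close> by simp
    then obtain \<delta> where \<delta>: "\<delta> > 0"
      "\<And>t. 0 \<le> t \<Longrightarrow> t < \<delta> \<Longrightarrow> 2 * (norm \<xi>)\<^sup>2 - 2 * Re (cinner (T t \<xi>) \<xi>) < \<epsilon>\<^sup>2"
      using semigroup_small_time by blast
    have close: "dist (v (s + b, \<xi>)) (v (s + a, \<xi>)) < \<epsilon>" if "a \<le> b" "b < a + \<delta>" for a b
    proof -
      have "(norm (v (r, \<xi>)))\<^sup>2 = (norm \<xi>)\<^sup>2" for r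
      proof -
        have "(norm (v (r, \<xi>)))\<^sup>2 = Re (cinner (v (r, \<xi>)) (v (r, \<xi>)))" by (simp add: cinner_self)
        then show ?thesis by (simp only: gram dilation_kernel_diagonal)
      qed
      moreover have "cinner (v (s + b, \<xi>)) (v (s + a, \<xi>)) = cinner (T (b - a) \<xi>) \<xi>"
        using \<open>a \<le> b\<close> by (simp add: gram dilation_kernel_later)
      ultimately have "(dist (v (s + b, \<xi>)) (v (s + a, \<xi>)))\<^sup>2
          = 2 * (norm \<xi>)\<^sup>2 - 2 * Re (cinner (T (b - a) \<xi>) \<xi>)"
        by (simp add: dist_norm norm_diff_square)
      also have "\<dots> < \<epsilon>\<^sup>2" using that by (intro \<delta>) auto
      finally show ?thesis using \<open>\<epsilon> > 0\<close> by (simp add: power2_less_imp_less)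
    qed
    show "\<exists>d>0. \<forall>t'\<in>UNIV. dist t' t < d \<longrightarrow> dist (v (act t' x)) (v (act t x)) < \<epsilon>"
    proof (intro exI[of _ \<delta>] conjI ballI impI)
      fix t' assume "dist t' t < \<delta>"
      then show "dist (v (act t' x)) (v (act t x)) < \<epsilon>"
        using close[of t t'] close[of t' t]
        by (cases "t \<le> t'") (auto simp: x act_def dist_real_def dist_commute)
    qed (rule \<delta>)
  qed
  obtain U where U: "unitary_representation U" "\<And>t x. U t (v x) = v (act t x)"
    "\<And>t y. (\<And>x. cinner (v x) y = 0) \<Longrightarrow> U t y = y"
  proof (rule unitary_group_from_action[of act v])
    show "act (s + t) x = act s (act t x)" for s t x
      by (simp add: act_def add_ac)
    show "cinner (v (act t x)) (v (act t y)) = cinner (v x) (v y)" for t x y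
      using dilation_kernel_shift[of T "fst x" t "snd x" "fst y" "snd y"] by (simp add: gram act_def)
  qed (auto simp: act_def cont[unfolded act_def])
  have U_lin: "bounded_clinear (U t)" for t
    using U(1) by (simp add: unitary_representation_def unitary_def)
  define N where "N = {v (t, \<xi>) - J (T t \<xi>) | t \<xi>. 0 \<le> t}"
  show ?thesis
  proof (rule that[OF U(1), folded A_def])
    show "U t y = y" if "\<And>a. a \<in> A \<Longrightarrow> cinner a y = 0" for t y
      by (rule U(3), rule closed_cspan_orthogonal[OF v_A that])
    show "N \<subseteq> closed_cspan A"
      using v_A v_0 by (auto simp: N_def A_def intro!: closed_cspan_intros intro: closed_cspan_base)
    show "cinner n (J \<xi>) = 0" if "n \<in> N" for n \<xi>
    proof -
      from that obtain t \<eta> where n: "n = v (t, \<eta>) - J (T t \<eta>)" "0 \<le> t" by (auto simp: N_def)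
      have "cinner (v (t, \<eta>)) (J \<xi>) = cinner (T t \<eta>) \<xi>"
        using gram[of "(t, \<eta>)" "(0, \<xi>)"] \<open>0 \<le> t\<close> by (simp add: v_0 dilation_kernel_later)
      then show ?thesis by (simp add: n cinner.diff_left J)
    qed
    show "U t (J \<xi>) - J (T t \<xi>) \<in> N" if "0 \<le> t" for t \<xi>
      using that U(2)[of t "(0, \<xi>)"] by (auto simp: N_def act_def v_0)
    show "U t n \<in> complex_vector.span N" if "0 \<le> t" "n \<in> N" for t n
    proof -
      from that obtain s \<xi> where n: "n = v (s, \<xi>) - J (T s \<xi>)" "0 \<le> s" by (auto simp: N_def)
      have "U t n = v (s + t, \<xi>) - v (t, T s \<xi>)"
        by (simp add: n(1) v_0[symmetric] bounded_clinear_diff[OF U_lin] U(2) act_def)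
      also have "\<dots> = (v (s + t, \<xi>) - J (T (s + t) \<xi>)) - (v (t, T s \<xi>) - J (T t (T s \<xi>)))"
        using semigroup_add[of t s \<xi>] \<open>0 \<le> t\<close> \<open>0 \<le> s\<close> by (simp add: add.commute)
      also have "\<dots> \<in> complex_vector.span N"
        using \<open>0 \<le> t\<close> \<open>0 \<le> s\<close>
        by (intro complex_vector.span_diff complex_vector.span_base) (auto simp: N_def)
      finally show ?thesis .
    qed
  qed
qed

end

section \<open>Orthonormal bases\<close>

lemma exists_orthonormal_basis: "\<exists>B :: 'h::complex_hilbert_space set. orthonormal_basis B"
proof -
  define Z where "Z = {B :: 'h set. (\<forall>x\<in>B. norm x = 1) \<and>
      (\<forall>x\<in>B. \<forall>y\<in>B. x \<noteq> y \<longrightarrow> cinner x y = 0)}"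
  have "\<exists>M\<in>Z. \<forall>B\<in>Z. M \<subseteq> B \<longrightarrow> B = M"
  proof (rule subset_Zorn_nonempty)
    show "Z \<noteq> {}" by (auto simp: Z_def)
    fix \<C> assume "subset.chain Z \<C>"
    then have in_Z: "\<C> \<subseteq> Z" and chain: "\<And>G H. G \<in> \<C> \<Longrightarrow> H \<in> \<C> \<Longrightarrow> G \<subseteq> H \<or> H \<subseteq> G"
      by (auto simp: subset.chain_def)
    show "\<Union>\<C> \<in> Z"
      unfolding Z_def
    proof (intro CollectI conjI ballI impI)
      show "norm x = 1" if "x \<in> \<Union>\<C>" for x
        using that in_Z by (auto simp: Z_def)
      show "cinner x y = 0" if xy: "x \<in> \<Union>\<C>" "y \<in> \<Union>\<C>" "x \<noteq> y" for x y
      proof -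
        obtain G where "G \<in> \<C>" "x \<in> G" "y \<in> G"
          using xy(1,2) chain by blast
        then show ?thesis using in_Z xy(3) by (auto simp: Z_def)
      qed
    qed
  qed
  then obtain M where "M \<in> Z" and max: "\<And>B. B \<in> Z \<Longrightarrow> M \<subseteq> B \<Longrightarrow> B = M" by blast
  have "x \<in> closed_cspan M" for x
  proof (rule ccontr)
    assume x: "x \<notin> closed_cspan M"
    obtain P where P: "\<And>y. P y \<in> closed_cspan M" "\<And>m y. m \<in> M \<Longrightarrow> cinner m (P y) = cinner m y"
      using gram_transport[of M "\<lambda>m. m" "\<lambda>m. m", unfolded image_ident] by blast
    define r where "r = x - P x"
    have "r \<noteq> 0" using x P(1)[of x] by (auto simp: r_def)
    define w where "w = scaleC (complex_of_real (1 / norm r)) r"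
    have orth: "cinner m w = 0" if "m \<in> M" for m
      using that by (simp add: w_def r_def cinner_scaleC_right cinner.diff_right P)
    have "norm w = 1" using \<open>r \<noteq> 0\<close> by (simp add: w_def norm_scaleC norm_divide)
    moreover have "cinner w m = 0" if "m \<in> M" for m
      using orth[OF that] cinner_eq_0_commute by blast
    ultimately have "insert w M \<in> Z"
      using \<open>M \<in> Z\<close> orth by (auto simp: Z_def)
    then have "w \<in> M" using max by blast
    then have "cinner w w = 0" by (rule orth)
    with \<open>norm w = 1\<close> show False by (simp add: cinner_self)
  qed
  then have "orthonormal_basis M"
    using \<open>M \<in> Z\<close> by (auto simp: orthonormal_basis_def Z_def closed_cspan_def)
  then show ?thesis ..
qed

text \<open>
  Transporting back from \<open>f b\<close> to \<open>b\<close> gives a contractive left inverse, so no norm is lost.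
\<close>

lemma isometry_from_orthonormal_basis:
  fixes f :: "'h::complex_hilbert_space \<Rightarrow> 'h"
  assumes B: "orthonormal_basis B"
    and f_norm: "\<And>b. b \<in> B \<Longrightarrow> norm (f b) = 1"
    and f_orth: "\<And>b c. b \<in> B \<Longrightarrow> c \<in> B \<Longrightarrow> b \<noteq> c \<Longrightarrow> cinner (f b) (f c) = 0"
  obtains J where "bounded_clinear J" "\<And>x. norm (J x) = norm x" "\<And>b. b \<in> B \<Longrightarrow> J b = f b"
    "\<And>x. J x \<in> closed_cspan (f ` B)"
proof -
  have "cinner (f b) (f c) = cinner b c" if "b \<in> B" "c \<in> B" for b c
    using that B f_norm f_orth by (cases "b = c") (auto simp: orthonormal_basis_def cinner_self)
  then have gram: "\<forall>b\<in>B. \<forall>c\<in>B. cinner (f b) (f c) = cinner b c"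
    and gram': "\<forall>b\<in>B. \<forall>c\<in>B. cinner b c = cinner (f b) (f c)" by simp_all
  obtain J where J: "bounded_clinear J" "\<And>y. norm (J y) \<le> norm y" "\<And>b. b \<in> B \<Longrightarrow> J b = f b"
    "\<And>y. J y \<in> closed_cspan (f ` B)"
    using gram_transport[OF gram] by blast
  obtain K where K: "bounded_clinear K" "\<And>y. norm (K y) \<le> norm y" "\<And>b. b \<in> B \<Longrightarrow> K (f b) = b"
    using gram_transport[OF gram'] by blast
  have "K (J x) = x" for x
  proof (rule bounded_clinear_eq_on_closed_cspan[OF bounded_clinear_compose[OF K(1) J(1)]
        bounded_clinear_ident, of B])
    show "x \<in> closed_cspan B" using B by (simp add: orthonormal_basis_def closed_cspan_def)
  qed (simp add: J(3) K(3))
  then have "norm (J x) = norm x" for x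
    using J(2)[of x] K(2)[of "J x"] by simp
  with that J show ?thesis by blast
qed

section \<open>The joint dilation of a family\<close>

lemma ordered_prod_simps [simp]:
  "ordered_prod T [] = id"
  "ordered_prod T ((i, t) # ws) = T i t \<circ> ordered_prod T ws"
  by (simp_all add: ordered_prod_def)

lemma unitary_norm: "unitary A \<Longrightarrow> norm (A x) = norm x"
proof -
  assume "unitary A"
  then have "cinner (A x) (A x) = cinner x x" by (simp add: unitary_def)
  then have "(norm (A x))\<^sup>2 = (norm x)\<^sup>2" by (simp only: cinner_self of_real_eq_iff)
  then show ?thesis by (simp add: power2_eq_iff_nonneg)
qed

lemma ordered_prod_unitary:
  assumes "\<And>i. i \<in> I \<Longrightarrow> unitary_representation (U i)" "ws \<in> lists (I \<times> {0..})"
  shows "bounded_clinear (ordered_prod U ws)" "norm (ordered_prod U ws x) = norm x"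
proof -
  have "bounded_clinear (ordered_prod U ws) \<and> (\<forall>x. norm (ordered_prod U ws x) = norm x)"
    using assms(2)
  proof (induction ws)
    case Nil
    then show ?case by (simp add: id_def bounded_clinear_ident)
  next
    case (Cons w ws)
    obtain i t where w: "w = (i, t)" by force
    then have "unitary (U i t)"
      using Cons assms(1) by (auto simp: unitary_representation_def)
    moreover from this have "bounded_clinear (U i t)" by (simp add: unitary_def)
    ultimately show ?case
      using Cons w bounded_clinear_compose[of "U i t" "ordered_prod U ws"]
      by (simp add: unitary_norm comp_def)
  qed
  then show "bounded_clinear (ordered_prod U ws)" "norm (ordered_prod U ws x) = norm x" by auto
qed

text \<open>
  The dilation spaces of the individual semigroups share \<open>J H\<close> and are otherwise mutually
  orthogonal, so \<open>U i\<close> fixes the errors produced by any other index. Hence the span \<open>R\<close> of all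
  errors is orthogonal to \<open>J H\<close> and invariant under every \<open>U i t\<close> with \<open>t \<ge> 0\<close>, and by induction
  over the word both products agree on \<open>J H\<close> up to \<open>R\<close>.
\<close>

lemma joint_unitary_dilation:
  fixes T :: "'i \<Rightarrow> real \<Rightarrow> 'h::complex_hilbert_space \<Rightarrow> 'h"
    and e :: "'i \<Rightarrow> real \<times> 'h \<Rightarrow> 'h" and B :: "'h set"
  assumes T: "\<And>i. i \<in> I \<Longrightarrow> contractive_C0_semigroup (T i)"
    and J_lin: "bounded_clinear J" and J_norm: "\<And>x. norm (J x) = norm x"
    and B: "closed_cspan B = UNIV"
    and e_norm: "\<And>i x. i \<in> I \<Longrightarrow> x \<in> \<rat> \<times> B \<Longrightarrow> norm (e i x) = 1"
    and e_orth: "\<And>i x j y. i \<in> I \<Longrightarrow> x \<in> \<rat> \<times> B \<Longrightarrow> j \<in> I \<Longrightarrow> y \<in> \<rat> \<times> B \<Longrightarrow> (i, x) \<noteq> (j, y)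
      \<Longrightarrow> cinner (e i x) (e j y) = 0"
    and e_J: "\<And>i x \<xi>. i \<in> I \<Longrightarrow> x \<in> \<rat> \<times> B \<Longrightarrow> cinner (J \<xi>) (e i x) = 0"
  shows "\<exists>U. (\<forall>i\<in>I. unitary_representation (U i)) \<and> (\<forall>ws\<in>lists (I \<times> {0..}). \<forall>\<xi> \<eta>.
      cinner (ordered_prod U ws (J \<xi>)) (J \<eta>) = cinner (ordered_prod T ws \<xi>) \<eta>)"
proof -
  have J: "cinner (J \<xi>) (J \<eta>) = cinner \<xi> \<eta>" for \<xi> \<eta>
    by (rule isometry_preserves_cinner[OF J_lin J_norm])
  define A where "A i = range J \<union> e i ` (\<rat> \<times> B)" for i
  have "\<exists>U N. unitary_representation U \<and>
      (\<forall>t y. (\<forall>a\<in>A i. cinner a y = 0) \<longrightarrow> U t y = y) \<and>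
      N \<subseteq> closed_cspan (A i) \<and> (\<forall>n\<in>N. \<forall>\<xi>. cinner n (J \<xi>) = 0) \<and>
      (\<forall>t\<ge>0. \<forall>\<xi>. U t (J \<xi>) - J (T i t \<xi>) \<in> N) \<and>
      (\<forall>t\<ge>0. \<forall>n\<in>N. U t n \<in> complex_vector.span N)" if i: "i \<in> I" for i
  proof (rule unitary_dilation[OF T[OF i] J B, of "e i"])
    show "norm (e i x) = 1" if "x \<in> \<rat> \<times> B" for x by (rule e_norm[OF i that])
    show "cinner (e i x) (e i y) = 0" if "x \<in> \<rat> \<times> B" "y \<in> \<rat> \<times> B" "x \<noteq> y" for x y
      using that i by (intro e_orth) auto
    show "cinner (J \<xi>) (e i x) = 0" if "x \<in> \<rat> \<times> B" for x \<xi> by (rule e_J[OF i that])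
  next
    fix U N
    assume "unitary_representation U"
      "\<And>t y. (\<And>a. a \<in> range J \<union> e i ` (\<rat> \<times> B) \<Longrightarrow> cinner a y = 0) \<Longrightarrow> U t y = y"
      "N \<subseteq> closed_cspan (range J \<union> e i ` (\<rat> \<times> B))"
      "\<And>n \<xi>. n \<in> N \<Longrightarrow> cinner n (J \<xi>) = 0"
      "\<And>t \<xi>. 0 \<le> t \<Longrightarrow> U t (J \<xi>) - J (T i t \<xi>) \<in> N"
      "\<And>t n. 0 \<le> t \<Longrightarrow> n \<in> N \<Longrightarrow> U t n \<in> complex_vector.span N"
    then show ?thesis
      unfolding A_def by (intro exI[of _ U] exI[of _ N]) simp
  qed
  then obtain U N where UN: "\<And>i. i \<in> I \<Longrightarrow> unitary_representation (U i) \<and>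
      (\<forall>t y. (\<forall>a\<in>A i. cinner a y = 0) \<longrightarrow> U i t y = y) \<and>
      N i \<subseteq> closed_cspan (A i) \<and> (\<forall>n\<in>N i. \<forall>\<xi>. cinner n (J \<xi>) = 0) \<and>
      (\<forall>t\<ge>0. \<forall>\<xi>. U i t (J \<xi>) - J (T i t \<xi>) \<in> N i) \<and>
      (\<forall>t\<ge>0. \<forall>n\<in>N i. U i t n \<in> complex_vector.span (N i))"
    by metis
  have U_rep: "unitary_representation (U i)" if "i \<in> I" for i
    using UN[OF that] by blast
  have U_lin: "bounded_clinear (U i t)" if "i \<in> I" for i t
    using U_rep[OF that] by (simp add: unitary_representation_def unitary_def)
  define R where "R = (\<Union>i\<in>I. N i)"
  have N_sub: "complex_vector.span (N i) \<subseteq> complex_vector.span R" if "i \<in> I" for i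
    using that by (intro complex_vector.span_mono) (auto simp: R_def)
  have N_foreign: "U i t n = n" if "i \<in> I" "j \<in> I" "i \<noteq> j" "n \<in> N j" for i j t n
  proof -
    have "cinner a n = 0" if a: "a \<in> A i" for a
    proof (cases "a \<in> range J")
      case True
      then show ?thesis
        using UN[OF \<open>j \<in> I\<close>] \<open>n \<in> N j\<close> cinner_eq_0_commute by blast
    next
      case False
      then obtain x where x: "x \<in> \<rat> \<times> B" "a = e i x" using a by (auto simp: A_def)
      have "cinner n a = 0"
      proof (rule closed_cspan_orthogonal)
        show "n \<in> closed_cspan (A j)" using UN[OF \<open>j \<in> I\<close>] \<open>n \<in> N j\<close> by blast
        fix b assume "b \<in> A j"
        then consider \<xi> where "b = J \<xi>" | y where "y \<in> \<rat> \<times> B" "b = e j y"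
          by (auto simp: A_def)
        then show "cinner b a = 0"
        proof cases
          case 1
          then show ?thesis using e_J[OF \<open>i \<in> I\<close> x(1)] x(2) by simp
        next
          case 2
          then show ?thesis
            using e_orth[OF \<open>j \<in> I\<close> 2(1) \<open>i \<in> I\<close> x(1)] x(2) \<open>i \<noteq> j\<close> by simp
        qed
      qed
      then show ?thesis using cinner_eq_0_commute by blast
    qed
    then show ?thesis using UN[OF \<open>i \<in> I\<close>] by blast
  qed
  have R_invariant: "U i t r \<in> complex_vector.span R"
    if "i \<in> I" "0 \<le> t" "r \<in> complex_vector.span R" for i t r
  proof (rule bounded_clinear_span_image[OF U_lin[OF \<open>i \<in> I\<close>] _ \<open>r \<in> _\<close>])
    fix n assume "n \<in> R"
    then obtain j where j: "j \<in> I" "n \<in> N j" by (auto simp: R_def)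
    show "U i t n \<in> complex_vector.span R"
    proof (cases "i = j")
      case True
      then show ?thesis using UN[OF j(1)] N_sub[OF j(1)] j(2) \<open>0 \<le> t\<close> by blast
    next
      case False
      then have "U i t n = n" using N_foreign that(1) j by blast
      then show ?thesis using \<open>n \<in> R\<close> by (simp add: complex_vector.span_base)
    qed
  qed
  have R_J: "cinner r (J \<eta>) = 0" if "r \<in> complex_vector.span R" for r \<eta>
  proof (rule closed_cspan_orthogonal)
    show "r \<in> closed_cspan R"
      using that closure_subset unfolding closed_cspan_def by blast
    show "cinner n (J \<eta>) = 0" if "n \<in> R" for n
      using that UN by (auto simp: R_def)
  qed
  have prod: "ordered_prod U ws (J \<xi>) - J (ordered_prod T ws \<xi>) \<in> complex_vector.span R"
    if "ws \<in> lists (I \<times> {0..})" for ws \<xi>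
    using that
  proof (induction ws)
    case Nil
    then show ?case by (simp add: complex_vector.span_zero)
  next
    case (Cons w ws)
    obtain i t where w: "w = (i, t)" by force
    then have it: "i \<in> I" "0 \<le> t" using Cons by auto
    define p where "p = ordered_prod T ws \<xi>"
    define r where "r = ordered_prod U ws (J \<xi>) - J p"
    have r: "r \<in> complex_vector.span R" using Cons by (simp add: r_def p_def)
    have "ordered_prod U (w # ws) (J \<xi>) - J (ordered_prod T (w # ws) \<xi>)
        = U i t (J p + r) - J (T i t p)"
      by (simp add: w r_def p_def)
    also have "\<dots> = (U i t (J p) - J (T i t p)) + U i t r"
      by (simp add: bounded_clinear_add[OF U_lin[OF it(1)]])
    also have "\<dots> \<in> complex_vector.span R"
    proof (rule complex_vector.span_add)
      have "U i t (J p) - J (T i t p) \<in> N i" using UN[OF it(1)] it(2) by blast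
      then show "U i t (J p) - J (T i t p) \<in> complex_vector.span R"
        using N_sub[OF it(1)] complex_vector.span_base by blast
      show "U i t r \<in> complex_vector.span R" by (rule R_invariant[OF it r])
    qed
    finally show ?case .
  qed
  have "cinner (ordered_prod U ws (J \<xi>)) (J \<eta>) = cinner (ordered_prod T ws \<xi>) \<eta>"
    if "ws \<in> lists (I \<times> {0..})" for ws \<xi> \<eta>
    using R_J[OF prod[OF that, of \<xi>], of \<eta>] by (simp add: cinner.diff_left J)
  with U_rep show ?thesis by blast
qed

section \<open>Approximation by dilations inside the given space\<close>

text \<open>
  The left summand labels the copy of the basis that spans \<open>J H\<close>, the right one the fresh directions
  for all semigroups.
\<close>

lemma injection_fixing_finite_set:
  assumes "infinite B" "|I| \<le>o |B|" "finite F" "F \<subseteq> B"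
  obtains \<rho> :: "'a + 'i \<times> real \<times> 'a \<Rightarrow> 'a" where
    "inj_on \<rho> (B <+> I \<times> \<rat> \<times> B)" "\<rho> ` (B <+> I \<times> \<rat> \<times> B) \<subseteq> B" "\<And>b. b \<in> F \<Longrightarrow> \<rho> (Inl b) = b"
proof -
  define W where "W = B <+> I \<times> (\<rat> :: real set) \<times> B"
  have B: "|B| \<le>o |B|" by (simp add: card_of_mono1)
  obtain f :: "real \<Rightarrow> nat" where "inj_on f \<rat>"
    using countable_rat by (rule countableE)
  then have "|\<rat> :: real set| \<le>o |UNIV :: nat set|"
    unfolding card_of_ordLeq[symmetric] by blast
  moreover have "|UNIV :: nat set| \<le>o |B|"
    using assms(1) by (simp add: infinite_iff_card_of_nat)
  ultimately have rationals: "|\<rat> :: real set| \<le>o |B|" by (rule ordLeq_transitive)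
  have infinite: "infinite (Field |B| :: 'a set)" using assms(1) by (simp add: Field_card_of)
  have "|(\<rat> :: real set) \<times> B| \<le>o |B|"
    by (rule card_of_Times_ordLeq_infinite_Field[OF infinite rationals B card_of_Card_order])
  note card_of_Times_ordLeq_infinite_Field[OF infinite assms(2) this card_of_Card_order]
  then have "|W| \<le>o |B|"
    unfolding W_def by (rule card_of_Plus_ordLeq_infinite_Field[OF infinite B _ card_of_Card_order])
  moreover have "|B| \<le>o |B - F|"
  proof -
    have inf: "infinite (Field |B - F| :: 'a set)"
      using assms(1,3) by (simp add: Field_card_of)
    have "|F| \<le>o |B - F|"
      using assms(3) inf
      by (intro ordLess_imp_ordLeq finite_ordLess_infinite card_of_Well_order)
        (simp_all add: Field_card_of)
    from card_of_Un_ordLeq_infinite_Field[OF inf _ this card_of_Card_order, of "B - F"]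
    have "|(B - F) \<union> F| \<le>o |B - F|" by (simp add: card_of_mono1)
    moreover have "(B - F) \<union> F = B" using assms(4) by blast
    ultimately show ?thesis by simp
  qed
  ultimately have "|W| \<le>o |B - F|" by (rule ordLeq_transitive)
  then obtain g where g: "inj_on g W" "g ` W \<subseteq> B - F"
    unfolding card_of_ordLeq[symmetric] by blast
  define \<rho> where "\<rho> w = (case w of Inl b \<Rightarrow> if b \<in> F then b else g w | Inr _ \<Rightarrow> g w)" for w
  have F: "\<rho> w = g w \<or> (\<exists>b\<in>F. w = Inl b \<and> \<rho> w = b)" for w
    by (auto simp: \<rho>_def split: sum.split)
  show ?thesis
  proof (rule that, fold W_def)
    show "inj_on \<rho> W"
    proof (rule inj_onI)
      fix w w' assume w: "w \<in> W" "w' \<in> W" "\<rho> w = \<rho> w'"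
      have "g w \<notin> F" "g w' \<notin> F" using g(2) w(1,2) by blast+
      with F[of w] F[of w'] w(3) have "w = w' \<or> g w = g w'" by metis
      then show "w = w'" using g(1) w(1,2) by (meson inj_onD)
    qed
    show "\<rho> ` W \<subseteq> B"
    proof (rule image_subsetI)
      fix w assume "w \<in> W"
      then have "g w \<in> B" using g(2) by blast
      with F[of w] assms(4) show "\<rho> w \<in> B" by (metis subsetD)
    qed
    show "\<rho> (Inl b) = b" if "b \<in> F" for b
      using that by (simp add: \<rho>_def)
  qed
qed

text \<open>
  All directions that the joint dilation requires are found inside the basis \<open>B\<close>, in such a way
  that the elements of \<open>F\<close> represent themselves.
\<close>

lemma approximate_unitary_dilation:
  fixes T :: "'i \<Rightarrow> real \<Rightarrow> 'h::complex_hilbert_space \<Rightarrow> 'h"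
  assumes T: "\<And>i. i \<in> I \<Longrightarrow> contractive_C0_semigroup (T i)"
    and B: "orthonormal_basis B" and inf: "infinite B" and I: "|I| \<le>o |B|"
    and F: "finite F" "F \<subseteq> B"
  shows "\<exists>U J. (\<forall>i\<in>I. unitary_representation (U i)) \<and> bounded_clinear J \<and>
    (\<forall>x. norm (J x) = norm x) \<and> (\<forall>b\<in>F. J b = b) \<and> (\<forall>ws\<in>lists (I \<times> {0..}). \<forall>\<xi> \<eta>.
      cinner (ordered_prod U ws (J \<xi>)) (J \<eta>) = cinner (ordered_prod T ws \<xi>) \<eta>)"
proof -
  obtain \<rho> :: "'h + 'i \<times> real \<times> 'h \<Rightarrow> 'h" where \<rho>: "inj_on \<rho> (B <+> I \<times> \<rat> \<times> B)"
    "\<rho> ` (B <+> I \<times> \<rat> \<times> B) \<subseteq> B" "\<And>b. b \<in> F \<Longrightarrow> \<rho> (Inl b) = b"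
    using injection_fixing_finite_set[OF inf I F] by blast
  have norm: "norm (\<rho> w) = 1" if "w \<in> B <+> I \<times> \<rat> \<times> B" for w
  proof -
    have "\<rho> w \<in> B" using that \<rho>(2) by blast
    then show ?thesis using B by (simp add: orthonormal_basis_def)
  qed
  have orth: "cinner (\<rho> w) (\<rho> w') = 0"
    if "w \<in> B <+> I \<times> \<rat> \<times> B" "w' \<in> B <+> I \<times> \<rat> \<times> B" "w \<noteq> w'" for w w'
  proof -
    have "\<rho> w \<in> B" "\<rho> w' \<in> B" using that \<rho>(2) by blast+
    moreover have "\<rho> w \<noteq> \<rho> w'" using that \<rho>(1) by (meson inj_onD)
    ultimately show ?thesis using B by (simp add: orthonormal_basis_def)
  qed
  obtain J where J: "bounded_clinear J" "\<And>x. norm (J x) = norm x" "\<And>b. b \<in> B \<Longrightarrow> J b = \<rho> (Inl b)"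
    "\<And>x. J x \<in> closed_cspan ((\<lambda>b. \<rho> (Inl b)) ` B)"
  proof (rule isometry_from_orthonormal_basis[OF B, of "\<lambda>b. \<rho> (Inl b)"])
    show "norm (\<rho> (Inl b)) = 1" if "b \<in> B" for b using that by (intro norm) auto
    show "cinner (\<rho> (Inl b)) (\<rho> (Inl c)) = 0" if "b \<in> B" "c \<in> B" "b \<noteq> c" for b c
      using that by (intro orth) auto
  qed blast
  have "\<exists>U. (\<forall>i\<in>I. unitary_representation (U i)) \<and> (\<forall>ws\<in>lists (I \<times> {0..}). \<forall>\<xi> \<eta>.
      cinner (ordered_prod U ws (J \<xi>)) (J \<eta>) = cinner (ordered_prod T ws \<xi>) \<eta>)"
  proof (rule joint_unitary_dilation[OF T J(1,2), where e = "\<lambda>i x. \<rho> (Inr (i, x))"])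
    show "closed_cspan B = UNIV" using B by (simp add: orthonormal_basis_def closed_cspan_def)
    show "norm (\<rho> (Inr (i, x))) = 1" if "i \<in> I" "x \<in> \<rat> \<times> B" for i x
      using that by (intro norm) auto
    show "cinner (\<rho> (Inr (i, x))) (\<rho> (Inr (j, y))) = 0"
      if "i \<in> I" "x \<in> \<rat> \<times> B" "j \<in> I" "y \<in> \<rat> \<times> B" "(i, x) \<noteq> (j, y)" for i x j y
      using that by (intro orth) auto
    show "cinner (J \<xi>) (\<rho> (Inr (i, x))) = 0" if "i \<in> I" "x \<in> \<rat> \<times> B" for i x \<xi>
    proof (rule closed_cspan_orthogonal[OF J(4)])
      fix a assume "a \<in> (\<lambda>b. \<rho> (Inl b)) ` B"
      then obtain b where "b \<in> B" "a = \<rho> (Inl b)" by blast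
      then show "cinner a (\<rho> (Inr (i, x))) = 0"
        using that by (simp only:) (intro orth, auto)
    qed
  qed
  moreover have "J b = b" if "b \<in> F" for b
    using that F(2) J(3)[of b] \<rho>(3)[of b] by auto
  ultimately show ?thesis using J(1,2) by blast
qed

text \<open>
  A product of unitaries does not increase errors, so replacing \<open>\<xi>, \<eta>\<close> by \<open>J \<xi>, J \<eta>\<close> costs an amount
  that does not depend on the word.
\<close>

lemma coefficient_deviation_bound:
  fixes T U :: "'i \<Rightarrow> real \<Rightarrow> 'h::complex_hilbert_space \<Rightarrow> 'h"
  assumes U: "\<And>i. i \<in> I \<Longrightarrow> unitary_representation (U i)"
    and J: "\<And>x. norm (J x) = norm x"
    and dil: "\<And>ws \<xi> \<eta>. ws \<in> lists (I \<times> {0..}) \<Longrightarrow>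
      cinner (ordered_prod U ws (J \<xi>)) (J \<eta>) = cinner (ordered_prod T ws \<xi>) \<eta>"
  shows "coefficient_deviation I T U \<xi> \<eta>
    \<le> ereal (norm (\<xi> - J \<xi>) * norm \<eta> + norm \<xi> * norm (\<eta> - J \<eta>))"
  unfolding coefficient_deviation_def
proof (rule SUP_least)
  fix ws :: "('i \<times> real) list" assume ws: "ws \<in> lists (I \<times> {0..})"
  let ?P = "ordered_prod U ws"
  note P = ordered_prod_unitary[OF U ws]
  have "cinner (ordered_prod T ws \<xi> - ?P \<xi>) \<eta>
      = - (cinner (?P (\<xi> - J \<xi>)) \<eta> + cinner (?P (J \<xi>)) (\<eta> - J \<eta>))"
    using dil[OF ws, of \<xi> \<eta>]
    by (simp add: cinner.diff_left cinner.diff_right bounded_clinear_diff[OF P(1)])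
  then have "cmod (cinner (ordered_prod T ws \<xi> - ?P \<xi>) \<eta>)
      \<le> cmod (cinner (?P (\<xi> - J \<xi>)) \<eta>) + cmod (cinner (?P (J \<xi>)) (\<eta> - J \<eta>))"
    by (simp only: norm_minus_cancel norm_triangle_ineq)
  also have "\<dots> \<le> norm (?P (\<xi> - J \<xi>)) * norm \<eta> + norm (?P (J \<xi>)) * norm (\<eta> - J \<eta>)"
    by (intro add_mono cauchy_schwarz)
  finally show "ereal (cmod (cinner (ordered_prod T ws \<xi> - ?P \<xi>) \<eta>))
      \<le> ereal (norm (\<xi> - J \<xi>) * norm \<eta> + norm \<xi> * norm (\<eta> - J \<eta>))"
    by (simp add: P(2) J)
qed

theorem corollary6p1:
  fixes I :: "'i set"
    and T :: "'i \<Rightarrow> real \<Rightarrow> 'h::complex_hilbert_space \<Rightarrow> 'h"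
  assumes "cinfinite (hilbert_dim TYPE('h))"
    and "I \<noteq> {}"
    and "|I| \<le>o hilbert_dim TYPE('h)"
    and "\<forall>i\<in>I. contractive_C0_semigroup (T i)"
  shows "\<exists>(\<Lambda> :: 'h set set) (le :: 'h set \<Rightarrow> 'h set \<Rightarrow> bool)
           (U :: 'h set \<Rightarrow> 'i \<Rightarrow> real \<Rightarrow> 'h \<Rightarrow> 'h).
      directed_set \<Lambda> le \<and>
      (\<forall>\<alpha>\<in>\<Lambda>. \<forall>i\<in>I. unitary_representation (U \<alpha> i)) \<and>
      (\<forall>\<xi> \<eta>. ((\<lambda>\<alpha>. coefficient_deviation I T (U \<alpha>) \<xi> \<eta>) \<longlongrightarrow> 0) (net_filter \<Lambda> le))"
proof -
  define B :: "'h set" where "B = (SOME B. orthonormal_basis B)"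
  have B: "orthonormal_basis B"
    unfolding B_def using exists_orthonormal_basis by (rule someI_ex)
  have inf: "infinite B" and I: "|I| \<le>o |B|"
    using assms(1,3) by (simp_all add: hilbert_dim_def B_def cinfinite_def Field_card_of)
  define \<Lambda> where "\<Lambda> = {F. finite F \<and> F \<subseteq> B}"
  define good where "good F U J \<longleftrightarrow> (\<forall>i\<in>I. unitary_representation (U i)) \<and> bounded_clinear J \<and>
    (\<forall>x. norm (J x) = norm x) \<and> (\<forall>b\<in>F. J b = b) \<and> (\<forall>ws\<in>lists (I \<times> {0..}). \<forall>\<xi> \<eta>.
      cinner (ordered_prod U ws (J \<xi>)) (J \<eta>) = cinner (ordered_prod T ws \<xi>) \<eta>)"
    for F and U :: "'i \<Rightarrow> real \<Rightarrow> 'h \<Rightarrow> 'h" and J :: "'h \<Rightarrow> 'h"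
  have "\<exists>U J. good F U J" if "F \<in> \<Lambda>" for F
    unfolding good_def
    using that assms(4) by (intro approximate_unitary_dilation[OF _ B inf I]) (auto simp: \<Lambda>_def)
  then obtain U J where good: "\<And>F. F \<in> \<Lambda> \<Longrightarrow> good F (U F) (J F)"
    by metis
  then have
    U: "\<And>F i. F \<in> \<Lambda> \<Longrightarrow> i \<in> I \<Longrightarrow> unitary_representation (U F i)" and
    J: "\<And>F. F \<in> \<Lambda> \<Longrightarrow> bounded_clinear (J F)" "\<And>F x. F \<in> \<Lambda> \<Longrightarrow> norm (J F x) = norm x"
      "\<And>F b. F \<in> \<Lambda> \<Longrightarrow> b \<in> F \<Longrightarrow> J F b = b" and
    dil: "\<And>F ws \<xi> \<eta>. F \<in> \<Lambda> \<Longrightarrow> ws \<in> lists (I \<times> {0..}) \<Longrightarrow>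
      cinner (ordered_prod (U F) ws (J F \<xi>)) (J F \<eta>) = cinner (ordered_prod T ws \<xi>) \<eta>"
    unfolding good_def by blast+
  have directed: "directed_set \<Lambda> (\<subseteq>)"
    unfolding directed_set_def
  proof (intro conjI ballI impI)
    show "\<Lambda> \<noteq> {}" by (auto simp: \<Lambda>_def)
    show "\<exists>H\<in>\<Lambda>. F \<subseteq> H \<and> G \<subseteq> H" if "F \<in> \<Lambda>" "G \<in> \<Lambda>" for F G
      using that by (intro bexI[of _ "F \<union> G"]) (auto simp: \<Lambda>_def)
  qed auto
  have J_lim: "((\<lambda>F. norm (\<xi> - J F \<xi>)) \<longlongrightarrow> 0) (net_filter \<Lambda> (\<subseteq>))" for \<xi>
  proof (rule tendstoI)
    fix \<epsilon> :: real assume "\<epsilon> > 0"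
    have "\<xi> \<in> closure (complex_vector.span B)" using B by (simp add: orthonormal_basis_def)
    then obtain p where p: "p \<in> complex_vector.span B" "dist p \<xi> < \<epsilon> / 2"
      using \<open>\<epsilon> > 0\<close> closure_approachable by (metis half_gt_zero)
    then obtain F0 r where F0: "finite F0" "F0 \<subseteq> B" "p = (\<Sum>b\<in>F0. scaleC (r b) b)"
      unfolding complex_vector.span_explicit by blast
    have "dist (norm (\<xi> - J F \<xi>)) 0 < \<epsilon>" if "F \<in> \<Lambda>" "F0 \<subseteq> F" for F
    proof -
      have "p \<in> complex_vector.span F"
        unfolding F0(3) using that(2)
        by (intro complex_vector.span_sum complex_vector.span_scale complex_vector.span_base) auto
      then have "p \<in> closed_cspan F"
        using closure_subset unfolding closed_cspan_def by blast
      then have "J F p = p"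
        by (rule bounded_clinear_eq_on_closed_cspan[OF J(1)[OF that(1)] bounded_clinear_ident, rotated])
          (rule J(3)[OF that(1)])
      then have "\<xi> - J F \<xi> = (\<xi> - p) - J F (\<xi> - p)"
        by (simp add: bounded_clinear_diff[OF J(1)[OF that(1)]])
      then have "norm (\<xi> - J F \<xi>) \<le> norm (\<xi> - p) + norm (J F (\<xi> - p))"
        by (simp only: norm_triangle_ineq4)
      also have "\<dots> < \<epsilon>"
        using p(2) by (simp add: J(2)[OF that(1)] dist_norm norm_minus_commute)
      finally show ?thesis by simp
    qed
    moreover have "F0 \<in> \<Lambda>" using F0 by (simp add: \<Lambda>_def)
    ultimately show "\<forall>\<^sub>F F in net_filter \<Lambda> (\<subseteq>). dist (norm (\<xi> - J F \<xi>)) 0 < \<epsilon>"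
      unfolding eventually_net_filter[OF directed] by blast
  qed
  have "((\<lambda>F. coefficient_deviation I T (U F) \<xi> \<eta>) \<longlongrightarrow> 0) (net_filter \<Lambda> (\<subseteq>))" for \<xi> \<eta>
  proof (rule tendsto_sandwich)
    have "0 \<le> coefficient_deviation I T (U F) \<xi> \<eta>" for F
      unfolding coefficient_deviation_def by (rule SUP_upper2[of "[]"]) auto
    then show "\<forall>\<^sub>F F in net_filter \<Lambda> (\<subseteq>). 0 \<le> coefficient_deviation I T (U F) \<xi> \<eta>"
      by simp
    let ?b = "\<lambda>F. norm (\<xi> - J F \<xi>) * norm \<eta> + norm \<xi> * norm (\<eta> - J F \<eta>)"
    have "coefficient_deviation I T (U F) \<xi> \<eta> \<le> ereal (?b F)" if "F \<in> \<Lambda>" for F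
      using that by (intro coefficient_deviation_bound U J dil)
    then show "\<forall>\<^sub>F F in net_filter \<Lambda> (\<subseteq>). coefficient_deviation I T (U F) \<xi> \<eta> \<le> ereal (?b F)"
      unfolding eventually_net_filter[OF directed]
      by (intro bexI[of _ "{}"]) (simp_all add: \<Lambda>_def)
    have "(?b \<longlongrightarrow> 0 * norm \<eta> + norm \<xi> * 0) (net_filter \<Lambda> (\<subseteq>))"
      by (intro tendsto_intros J_lim)
    then show "((\<lambda>F. ereal (?b F)) \<longlongrightarrow> 0) (net_filter \<Lambda> (\<subseteq>))"
      by (simp add: zero_ereal_def)
  qed simp
  with directed U show ?thesis by blast
qed

end
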